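(* Let $1\le p<2$ and let $\{a_n;\,n\ge1\}$ be an increasing sequence of positive real numbers such that $\lim_{n\to\infty}a_n=\infty$ and $\{n^{1/p}/a_n;\,n\ge1\}$ is a nondecreasing sequence. Let $(\mathbf{B},\|\cdot\|)$ be a real separable Banach space such that, for every symmetric sequence $\{X,X_n;\,n\ge1\}$ of i.i.d. $\mathbf{B}$-valued random variables, with $S_n=\sum_{i=1}^nX_i$, $$\frac{S_n}{a_n}\to_{\mathbb{P}}0\quad\text{if and only if}\quad\lim_{n\to\infty}n\,\mathbb{P}(\|X\|>a_n)=0 .$$ Then the Banach space $\mathbf{B}$ is of stable type $p$.
   Context: A $\mathbf{B}$-valued random variable is a Borel measurable map from a probability space into $\mathbf{B}$. A sequence $\{X,X_n;\,n\ge1\}$ of i.i.d. $\mathbf{B}$-valued random variables means that the $X_n$ are independent and each has the same distribution as $X$; it is called symmetric if $X$ and $-X$ have the same distribution. $\to_{\mathbb{P}}$ denotes convergence in probability. "Increasing" means strictly increasing (as opposed to "nondecreasing"). For $0<p\le2$, $\mathbf{B}$ is said to be of stable type $p$ if $\sum_{n=1}^\infty\Theta_nv_n$ converges almost surely whenever $\{v_n;\,n\ge1\}\subseteq\mathbf{B}$ satisfies $\sum_{n=1}^\infty\|v_n\|^p<\infty$, where $\{\Theta_n;\,n\ge1\}$ is a sequence of i.i.d. real stable random variables each with characteristic function $\psi(t)=\exp\{-|t|^p\}$, $-\infty<t<\infty$. *)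

theory Defs
  imports "HOL-Probability.Probability"
begin

text \<open>
  Sequences are indexed by \<open>n \<ge> 1\<close>; entries at index \<open>0\<close> are irrelevant.
  Equality of distributions is equality of the push-forward measures on the Borel sets.
\<close>

definition iid_copies ::
  "'w measure \<Rightarrow> ('w \<Rightarrow> 'b::topological_space) \<Rightarrow> (nat \<Rightarrow> 'w \<Rightarrow> 'b) \<Rightarrow> bool" where
  "iid_copies M X Xs \<longleftrightarrow>
     prob_space M \<and>
     X \<in> borel_measurable M \<and>
     prob_space.indep_vars M (\<lambda>_. borel) Xs {1..} \<and>
     (\<forall>n\<ge>1. distr M borel (Xs n) = distr M borel X)"

definition symmetric_rv :: "'w measure \<Rightarrow> ('w \<Rightarrow> 'b::real_normed_vector) \<Rightarrow> bool" where
  "symmetric_rv M X \<longleftrightarrow> distr M borel (\<lambda>\<omega>. - X \<omega>) = distr M borel X"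

definition tendsto_in_prob ::
  "'w measure \<Rightarrow> (nat \<Rightarrow> 'w \<Rightarrow> 'b::metric_space) \<Rightarrow> ('w \<Rightarrow> 'b) \<Rightarrow> bool" where
  "tendsto_in_prob M Y Z \<longleftrightarrow>
     (\<forall>\<epsilon>>0. (\<lambda>n. measure M {\<omega> \<in> space M. dist (Y n \<omega>) (Z \<omega>) > \<epsilon>}) \<longlonglongrightarrow> 0)"

text \<open>
  HOL cannot quantify over probability spaces of all types inside a formula.  Statements about all
  sequences of \<open>'b\<close>-valued random variables are therefore made for all probability spaces on the
  path type \<open>nat \<Rightarrow> 'b\<close>.  This is no restriction: the lemmas \<open>stable_type_any_space\<close> and
  \<open>wlln_any_space\<close> below transfer them to probability spaces of any type by passing to the joint
  distribution \<open>path_law\<close>, in which coordinate \<open>0\<close> carries \<open>X\<close>.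
\<close>

definition stable_type :: "real \<Rightarrow> 'b::real_normed_vector itself \<Rightarrow> bool" where
  "stable_type p (_::'b itself) \<longleftrightarrow>
     0 < p \<and> p \<le> 2 \<and>
     (\<forall>(M :: (nat \<Rightarrow> real) measure) \<Theta>.
        iid_copies M (\<Theta> 1) \<Theta> \<and>
        (\<forall>n\<ge>1. \<forall>t. char (distr M borel (\<Theta> n)) t = of_real (exp (- (\<bar>t\<bar> powr p)))) \<longrightarrow>
        (\<forall>v :: nat \<Rightarrow> 'b.
           summable (\<lambda>n. norm (v (Suc n)) powr p) \<longrightarrow>
           (AE \<omega> in M. summable (\<lambda>n. \<Theta> (Suc n) \<omega> *\<^sub>R v (Suc n)))))"

definition path_law ::
  "'w measure \<Rightarrow> ('w \<Rightarrow> 'b::topological_space) \<Rightarrow> (nat \<Rightarrow> 'w \<Rightarrow> 'b) \<Rightarrow> (nat \<Rightarrow> 'b) measure" where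
  "path_law M X Xs =
     distr M (\<Pi>\<^sub>M n\<in>UNIV. borel) (\<lambda>\<omega> n. if n = 0 then X \<omega> else Xs n \<omega>)"

lemma iid_copies_measurable:
  assumes "iid_copies M X Xs"
  shows "X \<in> borel_measurable M" "n \<ge> 1 \<Longrightarrow> Xs n \<in> borel_measurable M"
  using assms by (auto simp: iid_copies_def prob_space.indep_vars_def)

lemma measurable_path:
  assumes "iid_copies M X Xs"
  shows "(\<lambda>\<omega> n. if n = 0 then X \<omega> else Xs n \<omega>) \<in> M \<rightarrow>\<^sub>M (\<Pi>\<^sub>M n\<in>(UNIV::nat set). borel)"
proof (rule measurable_PiM_single')
  fix i :: nat
  show "(\<lambda>\<omega>. if i = 0 then X \<omega> else Xs i \<omega>) \<in> borel_measurable M"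
    using iid_copies_measurable(1)[OF assms] iid_copies_measurable(2)[OF assms, of i] by (cases "i = 0") auto
qed auto

lemma distr_path_law:
  assumes "iid_copies M X Xs" and "g \<in> (\<Pi>\<^sub>M n\<in>(UNIV::nat set). borel) \<rightarrow>\<^sub>M N"
  shows "distr (path_law M X Xs) N g = distr M N (\<lambda>\<omega>. g (\<lambda>n. if n = 0 then X \<omega> else Xs n \<omega>))"
  unfolding path_law_def using assms(2) measurable_path[OF assms(1)]
  by (subst distr_distr) (auto simp: comp_def)

lemma iid_copies_path_law:
  assumes iid: "iid_copies M X Xs"
  shows "iid_copies (path_law M X Xs) (\<lambda>f. f 0) (\<lambda>n f. f n)"
proof -
  let ?P = "\<Pi>\<^sub>M n\<in>(UNIV::nat set). (borel :: 'b measure)"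
  let ?N = "path_law M X Xs"
  interpret M: prob_space M using iid by (simp add: iid_copies_def)
  interpret N: prob_space ?N
    unfolding path_law_def by (rule M.prob_space_distr) (rule measurable_path[OF iid])
  have sets_N [measurable_cong]: "sets ?N = sets ?P"
    by (simp add: path_law_def)
  have coord: "(\<lambda>f. f n) \<in> borel_measurable ?P" for n
    by (rule measurable_component_singleton) simp
  have coordN: "(\<lambda>f. f n) \<in> borel_measurable ?N" for n
    using coord[of n] by (simp add: measurable_cong_sets[OF sets_N refl])
  have dist: "distr ?N borel (\<lambda>f. f n) = distr M borel (Xs n)" if "n \<ge> 1" for n
    using that distr_path_law[OF iid coord[of n]] by simp
  have res: "(\<lambda>f. restrict f {1..}) \<in> ?P \<rightarrow>\<^sub>M (\<Pi>\<^sub>M n\<in>{1..}. borel)"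
    by (rule measurable_restrict_subset) simp
  have "distr ?N (\<Pi>\<^sub>M n\<in>{1..}. borel) (\<lambda>f. \<lambda>n\<in>{1..}. f n)
      = distr M (\<Pi>\<^sub>M n\<in>{1..}. borel) (\<lambda>\<omega>. \<lambda>n\<in>{1..}. if n = 0 then X \<omega> else Xs n \<omega>)"
    using distr_path_law[OF iid res] by simp
  also have "\<dots> = distr M (\<Pi>\<^sub>M n\<in>{1..}. borel) (\<lambda>\<omega>. \<lambda>n\<in>{1..}. Xs n \<omega>)"
    by (intro arg_cong[where f = "distr M _"] ext) (auto simp: restrict_def)
  also have "\<dots> = (\<Pi>\<^sub>M n\<in>{1..}. distr M borel (Xs n))"
    using iid iid_copies_measurable[OF iid]
    by (subst M.indep_vars_iff_distr_eq_PiM'[symmetric]) (auto simp: iid_copies_def)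
  also have "\<dots> = (\<Pi>\<^sub>M n\<in>{1..}. distr ?N borel (\<lambda>f. f n))"
    by (rule PiM_cong) (auto simp: dist)
  finally have "N.indep_vars (\<lambda>_. borel) (\<lambda>n f. f n) {1..}"
    by (subst N.indep_vars_iff_distr_eq_PiM') (auto intro: coordN)
  moreover have "distr ?N borel (\<lambda>f. f 0) = distr M borel X"
    using distr_path_law[OF iid coord[of 0]] by simp
  ultimately show ?thesis
    using dist iid coordN N.prob_space_axioms by (auto simp: iid_copies_def)
qed

lemma measure_path_law:
  assumes iid: "iid_copies M X Xs" and "Measurable.pred (\<Pi>\<^sub>M n\<in>(UNIV::nat set). borel) P"
  shows "measure (path_law M X Xs) {f \<in> space (path_law M X Xs). P f} =
         measure M {\<omega> \<in> space M. P (\<lambda>n. if n = 0 then X \<omega> else Xs n \<omega>)}"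
proof -
  have "{f \<in> space (path_law M X Xs). P f} \<in> sets (\<Pi>\<^sub>M n\<in>(UNIV::nat set). (borel :: 'b measure))"
    using assms(2) by (auto simp: path_law_def)
  then show ?thesis
    unfolding path_law_def using measurable_space[OF measurable_path[OF iid]]
    by (subst measure_distr[OF measurable_path[OF iid]])
       (auto simp: path_law_def intro!: arg_cong[where f = "measure M"])
qed

lemma stable_type_any_space:
  fixes M :: "'w measure" and v :: "nat \<Rightarrow> 'b::real_normed_vector"
  assumes st: "stable_type p TYPE('b)"
    and iid: "iid_copies M (\<Theta> 1) \<Theta>"
    and char: "\<And>n t. n \<ge> 1 \<Longrightarrow> char (distr M borel (\<Theta> n)) t = of_real (exp (- (\<bar>t\<bar> powr p)))"
    and v: "summable (\<lambda>n. norm (v (Suc n)) powr p)"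
  shows "AE \<omega> in M. summable (\<lambda>n. \<Theta> (Suc n) \<omega> *\<^sub>R v (Suc n))"
proof -
  let ?N = "path_law M (\<Theta> 1) \<Theta>"
  have N: "iid_copies ?N (\<lambda>f. f 0) (\<lambda>n f. f n)"
    by (rule iid_copies_path_law[OF iid])
  have dist: "distr ?N borel (\<lambda>f. f n) = distr M borel (\<Theta> n)" if "n \<ge> 1" for n
    using that by (subst distr_path_law[OF iid]) auto
  have "iid_copies ?N (\<lambda>f. f 1) (\<lambda>n f. f n)"
    using N iid_copies_measurable(2)[OF N, of 1] unfolding iid_copies_def by auto
  moreover have "char (distr ?N borel (\<lambda>f. f n)) t = of_real (exp (- (\<bar>t\<bar> powr p)))"
    if "n \<ge> 1" for n t
    using char[OF that] dist[OF that] by simp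
  ultimately have "AE f in ?N. summable (\<lambda>n. f (Suc n) *\<^sub>R v (Suc n))"
    using st[unfolded stable_type_def, THEN conjunct2, THEN conjunct2,
        THEN spec[of _ ?N], THEN spec[of _ "\<lambda>n f. f n"]] v by simp
  then show ?thesis
    unfolding path_law_def by (auto dest!: AE_distrD[OF measurable_path[OF iid]])
qed

lemma wlln_any_space:
  fixes M :: "'w measure" and X :: "'w \<Rightarrow> 'b::{banach, second_countable_topology}"
  assumes path:
      "\<And>(M :: (nat \<Rightarrow> 'b) measure) (X :: (nat \<Rightarrow> 'b) \<Rightarrow> 'b) Xs.
         iid_copies M X Xs \<Longrightarrow> symmetric_rv M X \<Longrightarrow>
         tendsto_in_prob M (\<lambda>n \<omega>. (\<Sum>i=1..n. Xs i \<omega>) /\<^sub>R a n) (\<lambda>_. 0) \<longleftrightarrow>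
         (\<lambda>n. real n * measure M {\<omega> \<in> space M. norm (X \<omega>) > a n}) \<longlonglongrightarrow> 0"
    and iid: "iid_copies M X Xs" and sym: "symmetric_rv M X"
  shows "tendsto_in_prob M (\<lambda>n \<omega>. (\<Sum>i=1..n. Xs i \<omega>) /\<^sub>R a n) (\<lambda>_. 0) \<longleftrightarrow>
         (\<lambda>n. real n * measure M {\<omega> \<in> space M. norm (X \<omega>) > a n}) \<longlonglongrightarrow> 0"
proof -
  let ?N = "path_law M X Xs"
  have "symmetric_rv ?N (\<lambda>f. f 0)"
    using sym unfolding symmetric_rv_def
    by (subst (1 2) distr_path_law[OF iid]) auto
  note * = path[OF iid_copies_path_law[OF iid] this]
  have "(\<Sum>i=1..n. if i = 0 then X \<omega> else Xs i \<omega>) = (\<Sum>i=1..n. Xs i \<omega>)" for n \<omega>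
    by (rule sum.cong) auto
  then have "tendsto_in_prob ?N (\<lambda>n f. (\<Sum>i=1..n. f i) /\<^sub>R a n) (\<lambda>_. 0) \<longleftrightarrow>
      tendsto_in_prob M (\<lambda>n \<omega>. (\<Sum>i=1..n. Xs i \<omega>) /\<^sub>R a n) (\<lambda>_. 0)"
    unfolding tendsto_in_prob_def by (subst measure_path_law[OF iid]) auto
  moreover have "measure ?N {f \<in> space ?N. norm (f 0) > a n} =
      measure M {\<omega> \<in> space M. norm (X \<omega>) > a n}" for n
    by (subst measure_path_law[OF iid]) auto
  ultimately show ?thesis
    using * by simp
qed

end

theory Submission
  imports Defs
begin

text \<open>
  Let \<open>\<theta>\<^sub>l\<close> be i.i.d. \<open>p\<close>-stable and suppose that \<open>\<Sum>\<^sub>l \<theta>\<^sub>l w\<^sub>l\<close> diverges with positive probability although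
  \<open>V = \<Sum>\<^sub>l \<parallel>w\<^sub>l\<parallel>\<^sup>p\<close> is finite.  Then there are \<open>\<epsilon> > 0\<close> and finite blocks \<open>B\<^sub>k\<close> of indices \<open>l \<ge> k\<close> with
  \<open>\<P>(\<parallel>\<Sum>\<^sub>l\<^sub>\<in>\<^sub>B \<theta>\<^sub>l w\<^sub>l\<parallel> > \<epsilon>) > \<epsilon>\<close> for \<open>B = B\<^sub>k\<close>.  Choose an index \<open>I\<close> with probabilities \<open>\<parallel>w\<^sub>l\<parallel>\<^sup>p / V\<close>, let \<open>\<eta>\<close> be an independent
  \<open>p\<close>-stable variable, and let \<open>m = \<lceil>(\<bar>\<eta>\<bar> / c)\<^sup>p\<rceil>\<close>.  The variable \<open>X\<close> of norm \<open>a\<^sub>m\<close>, direction \<open>w\<^sub>I / \<parallel>w\<^sub>I\<parallel>\<close> and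
  the sign of \<open>\<eta>\<close>, set to zero if \<open>m\<close> exceeds a finite truncation level \<open>T\<^sub>I\<close>, satisfies
  \<open>n \<P>(\<parallel>X\<parallel> > a\<^sub>n) \<le> n \<P>(m > n) \<P>(T\<^sub>I > n) \<rightarrow> 0\<close>, because \<open>n \<P>(m > n)\<close> is bounded.
  On the other hand, if \<open>n\<close> is large enough for the law of large numbers on the block \<open>B\<^sub>k\<close>, then by strict
  stability the partial sums of \<open>\<eta>\<^sub>j w\<^sub>I / \<parallel>w\<^sub>I\<parallel>\<close> over the steps with \<open>I \<in> B\<^sub>k\<close>, divided by \<open>n\<^bsup>1/p\<^esup>\<close>, are at least as
  spread out as a multiple of \<open>\<Sum>\<^sub>l\<^sub>\<in>\<^sub>B \<theta>\<^sub>l w\<^sub>l\<close>.  As \<open>n\<^bsup>1/p\<^esup> / a\<^sub>n\<close> is nondecreasing, the contraction principle bounds them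
  by \<open>S\<^sub>n / a\<^sub>n\<close>, which therefore does not converge to zero in probability.
\<close>

section \<open>Contraction and Levy inequalities for random signs\<close>

text \<open>A choice of signs is encoded by the set \<open>A\<close> of indices with sign -1. A sum
  over \<open>Pow J\<close> is thus \<open>2 ^ card J\<close> times an expectation over independent
  random signs.\<close>

definition flip :: "nat set \<Rightarrow> (nat \<Rightarrow> 'b::uminus) \<Rightarrow> nat \<Rightarrow> 'b" where
  "flip A x j = (if j \<in> A then - x j else x j)"

lemma sum_Pow_insert:
  fixes F :: "'a set \<Rightarrow> 'c::comm_monoid_add"
  assumes "finite J" "j \<notin> J"
  shows "(\<Sum>A\<in>Pow (insert j J). F A) = (\<Sum>A\<in>Pow J. F A + F (insert j A))"
proof -
  have "inj_on (insert j) (Pow J)"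
    using assms(2) by (auto simp: inj_on_def)
  moreover have "Pow J \<inter> insert j ` Pow J = {}"
    using assms(2) by auto
  ultimately show ?thesis
    using assms(1) by (simp add: Pow_insert sum.union_disjoint sum.reindex sum.distrib)
qed

lemma sum_flip_insert:
  fixes x :: "nat \<Rightarrow> 'b::real_vector"
  assumes "finite J" "j \<notin> J" "A \<subseteq> J"
  shows "(\<Sum>i\<in>insert j J. \<alpha> i *\<^sub>R flip A x i) = \<alpha> j *\<^sub>R x j + (\<Sum>i\<in>J. \<alpha> i *\<^sub>R flip A x i)"
    and "(\<Sum>i\<in>insert j J. \<alpha> i *\<^sub>R flip (insert j A) x i) = - \<alpha> j *\<^sub>R x j + (\<Sum>i\<in>J. \<alpha> i *\<^sub>R flip A x i)"
proof -
  have "(\<Sum>i\<in>J. \<alpha> i *\<^sub>R flip (insert j A) x i) = (\<Sum>i\<in>J. \<alpha> i *\<^sub>R flip A x i)"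
    using assms by (intro sum.cong) (auto simp: flip_def)
  then show "(\<Sum>i\<in>insert j J. \<alpha> i *\<^sub>R flip A x i) = \<alpha> j *\<^sub>R x j + (\<Sum>i\<in>J. \<alpha> i *\<^sub>R flip A x i)"
    and "(\<Sum>i\<in>insert j J. \<alpha> i *\<^sub>R flip (insert j A) x i) = - \<alpha> j *\<^sub>R x j + (\<Sum>i\<in>J. \<alpha> i *\<^sub>R flip A x i)"
    using assms by (auto simp: flip_def)
qed

lemmas sum_flip_insert1 = sum_flip_insert[where \<alpha> = "\<lambda>_. 1", simplified]

text \<open>The vector \<open>y\<close> is the midpoint of the two sums belonging to
  \<open>A\<close> and \<open>J - A\<close>, so one of them has norm above \<open>t\<close>. This is
  the source of the factor 2 in both sign inequalities.\<close>

lemma half_signs_large: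
  fixes x :: "nat \<Rightarrow> 'b::real_normed_vector"
  assumes "finite J" "t < norm y"
  shows "2 ^ card J \<le> 2 * (\<Sum>A\<in>Pow J. of_bool (t < norm (y + (\<Sum>j\<in>J. flip A x j))) :: real)"
proof -
  let ?g = "\<lambda>A. of_bool (t < norm (y + (\<Sum>j\<in>J. flip A x j))) :: real"
  have compl: "(\<Sum>A\<in>Pow J. ?g A) = (\<Sum>A\<in>Pow J. ?g (J - A))"
    by (rule sum.reindex_bij_witness[where i = "\<lambda>A. J - A" and j = "\<lambda>A. J - A"])
       (auto simp: double_diff Diff_Diff_Int Int_absorb1)
  have "1 \<le> ?g A + ?g (J - A)" if "A \<in> Pow J" for A
  proof -
    have "(\<Sum>j\<in>J. flip (J - A) x j) = - (\<Sum>j\<in>J. flip A x j)"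
      unfolding sum_negf[symmetric] using that by (intro sum.cong) (auto simp: flip_def)
    then have "2 *\<^sub>R y = (y + (\<Sum>j\<in>J. flip A x j)) + (y + (\<Sum>j\<in>J. flip (J - A) x j))"
      by (simp add: scaleR_2)
    then have "2 * norm y \<le> norm (y + (\<Sum>j\<in>J. flip A x j)) + norm (y + (\<Sum>j\<in>J. flip (J - A) x j))"
      by (metis norm_triangle_ineq norm_scaleR abs_numeral)
    then show ?thesis using assms(2) by auto
  qed
  then have "(\<Sum>A\<in>Pow J. 1) \<le> (\<Sum>A\<in>Pow J. ?g A + ?g (J - A))"
    by (intro sum_mono) auto
  then show ?thesis
    using compl assms(1) by (simp add: card_Pow sum.distrib)
qed

text \<open>
  The common factor \<open>c\<close> makes the induction work: the element with the largest weight is split off and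
  the remaining coefficients are divided by its weight.
\<close>

lemma contraction_signs_scaled:
  fixes x :: "nat \<Rightarrow> 'b::real_normed_vector"
  assumes "finite J" "\<And>j. j \<in> J \<Longrightarrow> 0 \<le> \<beta> j" "0 \<le> c" "\<And>j. j \<in> J \<Longrightarrow> c * \<beta> j \<le> 1"
  shows "(\<Sum>A\<in>Pow J. of_bool (t < norm (y + (\<Sum>j\<in>J. (c * \<beta> j) *\<^sub>R flip A x j))) :: real)
    \<le> 2 * (\<Sum>A\<in>Pow J. of_bool (t < norm (y + (\<Sum>j\<in>J. flip A x j))))"
  using assms
\<comment> \<open>The inserted index has the largest \<open>\<beta>\<close>, so dividing by its
  weight keeps the other coefficients at most 1. The offset \<open>y\<close> varies because it
  absorbs \<open>x j0\<close> with either sign.\<close>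
proof (induction J arbitrary: y c rule: finite_ranking_induct[where f = \<beta>])
  case empty
  then show ?case by simp
next
  case (insert j0 J)
  let ?I = "insert j0 J"
  let ?f = "\<lambda>c y. (\<Sum>A\<in>Pow J. of_bool (t < norm (y + (\<Sum>j\<in>J. (c * \<beta> j) *\<^sub>R flip A x j))) :: real)"
  let ?g = "\<lambda>y. (\<Sum>A\<in>Pow J. of_bool (t < norm (y + (\<Sum>j\<in>J. flip A x j))) :: real)"
  show ?case
  proof (cases "j0 \<in> J")
    case True
    then show ?thesis using insert by (simp add: insert_absorb)
  next
    case j0: False
    show ?thesis
    proof (cases "t < norm y")
      case True
      have "(\<Sum>A\<in>Pow ?I. of_bool (t < norm (y + (\<Sum>j\<in>?I. (c * \<beta> j) *\<^sub>R flip A x j))) :: real) \<le> (\<Sum>A\<in>Pow ?I. 1)"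
        by (intro sum_mono) auto
      also have "\<dots> = 2 ^ card ?I"
        using insert.hyps by (simp add: card_Pow del: Pow_insert)
      also have "\<dots> \<le> 2 * (\<Sum>A\<in>Pow ?I. of_bool (t < norm (y + (\<Sum>j\<in>?I. flip A x j))))"
        using insert.hyps True by (intro half_signs_large) auto
      finally show ?thesis .
    next
      case False
      define a where "a = c * \<beta> j0"
      \<comment> \<open>After splitting off \<open>j0\<close> the other coefficients factor as
        \<open>a * (c' * \<beta> j)\<close>. If \<open>\<beta> j0 = 0\<close>, then
        \<open>\<beta>\<close> vanishes on all of \<open>J\<close> and the default value
        \<open>c' = 0\<close> serves.\<close>
      define c' where "c' = 1 / \<beta> j0"
      have a: "0 \<le> a" "a \<le> 1"
        using insert.prems by (auto simp: a_def)
      have c': "0 \<le> c'" "c' * \<beta> j \<le> 1" if "j \<in> J" for j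
        using insert.prems(1)[of j0] insert.prems(1)[of j] insert.hyps(2)[OF that] that
        by (auto simp: c'_def divide_simps)
      have ac': "c * \<beta> j = a * c' * \<beta> j" if "j \<in> J" for j
        using insert.prems(1)[of j0] insert.prems(1)[of j] insert.hyps(2)[OF that] that
        by (auto simp: a_def c'_def)
      \<comment> \<open>Convexity: the vector with weight \<open>a\<close> lies between
        \<open>y\<close> and the vector with weight 1. As \<open>y\<close> has norm at most
        \<open>t\<close>, an excess at the former forces one at the latter.\<close>
      have step: "t < norm (y + z + (\<Sum>j\<in>J. (c' * \<beta> j) *\<^sub>R flip A x j))"
        if "t < norm (y + a *\<^sub>R z + (\<Sum>j\<in>J. (c * \<beta> j) *\<^sub>R flip A x j))" for z A
      proof (rule ccontr)
        let ?w = "y + z + (\<Sum>j\<in>J. (c' * \<beta> j) *\<^sub>R flip A x j)"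
        assume "\<not> t < norm ?w"
        have "(\<Sum>j\<in>J. (c * \<beta> j) *\<^sub>R flip A x j) = a *\<^sub>R (\<Sum>j\<in>J. (c' * \<beta> j) *\<^sub>R flip A x j)"
          unfolding scaleR_sum_right using ac' by (intro sum.cong) (auto simp: mult.assoc)
        then have "y + a *\<^sub>R z + (\<Sum>j\<in>J. (c * \<beta> j) *\<^sub>R flip A x j) = (1 - a) *\<^sub>R y + a *\<^sub>R ?w"
          by (simp add: algebra_simps)
        also have "norm \<dots> \<le> (1 - a) * norm y + a * norm ?w"
          using a norm_triangle_ineq[of "(1 - a) *\<^sub>R y" "a *\<^sub>R ?w"] by simp
        also have "\<dots> \<le> t"
          using a False \<open>\<not> t < norm ?w\<close> by (intro convex_bound_le) auto
        finally show False using that by simp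
      qed
      have IH: "?f c' w \<le> 2 * ?g w" for w
      proof (cases "J = {}")
        case False
        then have "0 \<le> c'" using c' by blast
        then show ?thesis using c' insert.prems by (intro insert.IH) auto
      qed simp
      have "(\<Sum>A\<in>Pow ?I. of_bool (t < norm (y + (\<Sum>j\<in>?I. (c * \<beta> j) *\<^sub>R flip A x j))) :: real)
          = (\<Sum>A\<in>Pow J. of_bool (t < norm (y + a *\<^sub>R x j0 + (\<Sum>j\<in>J. (c * \<beta> j) *\<^sub>R flip A x j)))
              + of_bool (t < norm (y + a *\<^sub>R (- x j0) + (\<Sum>j\<in>J. (c * \<beta> j) *\<^sub>R flip A x j))))"
        unfolding sum_Pow_insert[OF insert.hyps(1) j0]
        using insert.hyps j0 by (intro sum.cong) (auto simp: sum_flip_insert a_def algebra_simps simp del: sum.insert)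
      also have "\<dots> \<le> ?f c' (y + x j0) + ?f c' (y - x j0)"
        unfolding sum.distrib
        using step[of "x j0"] step[of "- x j0"] by (intro add_mono sum_mono) auto
      also have "\<dots> \<le> 2 * ?g (y + x j0) + 2 * ?g (y - x j0)"
        by (intro add_mono IH)
      also have "\<dots> = 2 * (\<Sum>A\<in>Pow ?I. of_bool (t < norm (y + (\<Sum>j\<in>?I. flip A x j))))"
        unfolding sum_Pow_insert[OF insert.hyps(1) j0] distrib_left[symmetric] sum.distrib[symmetric]
        using insert.hyps j0
        by (intro arg_cong2[where f = "(*)"] refl sum.cong)
           (auto simp: sum_flip_insert1 add.assoc algebra_simps simp del: sum.insert)
      finally show ?thesis .
    qed
  qed
qed

lemma contraction_signs:
  fixes x :: "nat \<Rightarrow> 'b::real_normed_vector"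
  assumes "finite J" "\<And>j. j \<in> J \<Longrightarrow> 0 \<le> \<alpha> j \<and> \<alpha> j \<le> 1"
  shows "(\<Sum>A\<in>Pow J. of_bool (t < norm (\<Sum>j\<in>J. \<alpha> j *\<^sub>R flip A x j)) :: real)
    \<le> 2 * (\<Sum>A\<in>Pow J. of_bool (t < norm (\<Sum>j\<in>J. flip A x j)))"
  using contraction_signs_scaled[of J \<alpha> 1 t 0 x] assms by simp

text \<open>Downward induction on \<open>m\<close>. If \<open>norm y\<close> exceeds
  \<open>t\<close>, half of all sign choices suffice; otherwise \<open>k = m\<close> contributes
  nothing and the path restarts from \<open>y + x m\<close> or \<open>y - x m\<close>, which is why
  the offset \<open>y\<close> is general.\<close>

lemma Levy_signs:
  fixes x :: "nat \<Rightarrow> 'b::real_normed_vector"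
  assumes "m \<le> n"
  shows "(\<Sum>A\<in>Pow {m..<n}. of_bool (\<exists>k\<in>{m..n}. t < norm (y + (\<Sum>j\<in>{m..<k}. flip A x j))) :: real)
    \<le> 2 * (\<Sum>A\<in>Pow {m..<n}. of_bool (t < norm (y + (\<Sum>j\<in>{m..<n}. flip A x j))))"
  using assms
proof (induction m arbitrary: y rule: inc_induct)
  case base
  then show ?case by simp
next
  case (step m)
  let ?J = "{Suc m..<n}"
  have I: "{m..<n} = insert m ?J"
    using step.hyps by auto
  let ?f = "\<lambda>y. (\<Sum>A\<in>Pow ?J. of_bool (\<exists>k\<in>{Suc m..n}. t < norm (y + (\<Sum>j\<in>{Suc m..<k}. flip A x j))) :: real)"
  let ?g = "\<lambda>y. (\<Sum>A\<in>Pow ?J. of_bool (t < norm (y + (\<Sum>j\<in>?J. flip A x j))) :: real)"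
  show ?case
  proof (cases "t < norm y")
    case True
    have "(\<Sum>A\<in>Pow {m..<n}. of_bool (\<exists>k\<in>{m..n}. t < norm (y + (\<Sum>j\<in>{m..<k}. flip A x j))) :: real)
        \<le> (\<Sum>A\<in>Pow {m..<n}. 1)"
      by (intro sum_mono) auto
    also have "\<dots> = 2 ^ card {m..<n}"
      by (simp add: card_Pow)
    also have "\<dots> \<le> 2 * (\<Sum>A\<in>Pow {m..<n}. of_bool (t < norm (y + (\<Sum>j\<in>{m..<n}. flip A x j))))"
      using True by (intro half_signs_large) auto
    finally show ?thesis .
  next
    case False
    have split: "(\<exists>k\<in>{m..n}. t < norm (y + (\<Sum>j\<in>{m..<k}. h j))) \<longleftrightarrow>
        (\<exists>k\<in>{Suc m..n}. t < norm (y + h m + (\<Sum>j\<in>{Suc m..<k}. h j)))" for h :: "nat \<Rightarrow> 'b"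
    proof -
      have "{m..n} = insert m {Suc m..n}"
        using step.hyps by auto
      then have "(\<exists>k\<in>{m..n}. t < norm (y + (\<Sum>j\<in>{m..<k}. h j))) \<longleftrightarrow>
          (\<exists>k\<in>{Suc m..n}. t < norm (y + (\<Sum>j\<in>{m..<k}. h j)))"
        using False by simp
      also have "\<dots> \<longleftrightarrow> (\<exists>k\<in>{Suc m..n}. t < norm (y + h m + (\<Sum>j\<in>{Suc m..<k}. h j)))"
        by (intro bex_cong refl) (simp add: sum.atLeast_Suc_lessThan add.assoc)
      finally show ?thesis .
    qed
    have flip_eq: "(\<Sum>j\<in>{Suc m..<k}. flip (insert m A) x j) = (\<Sum>j\<in>{Suc m..<k}. flip A x j)" for A k
      by (intro sum.cong) (auto simp: flip_def)
    have flip_m: "flip A x m = x m" "flip (insert m A) x m = - x m" if "A \<subseteq> ?J" for A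
      using that by (auto simp: flip_def)
    have nm: "m \<notin> ?J" by simp
    have "(\<Sum>A\<in>Pow {m..<n}. of_bool (\<exists>k\<in>{m..n}. t < norm (y + (\<Sum>j\<in>{m..<k}. flip A x j))) :: real)
        = ?f (y + x m) + ?f (y - x m)"
      unfolding I sum_Pow_insert[OF finite_atLeastLessThan nm] split sum.distrib[symmetric]
      by (intro sum.cong refl) (simp add: flip_m flip_eq)
    also have "\<dots> \<le> 2 * ?g (y + x m) + 2 * ?g (y - x m)"
      by (intro add_mono step.IH)
    also have "\<dots> = 2 * (\<Sum>A\<in>Pow {m..<n}. of_bool (t < norm (y + (\<Sum>j\<in>{m..<n}. flip A x j))))"
      unfolding I sum_Pow_insert[OF finite_atLeastLessThan nm] distrib_left[symmetric] sum.distrib[symmetric]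
      by (intro arg_cong2[where f = "(*)"] refl sum.cong)
         (auto simp: sum_flip_insert1 algebra_simps simp del: sum.insert)
    finally show ?thesis .
  qed
qed

section \<open>Sequences of i.i.d. symmetric real variables\<close>

text \<open>Each \<open>T A\<close> preserves \<open>M\<close>, so the expected number of sets
  \<open>A\<close> with \<open>T A \<omega>\<close> in an event is \<open>2 ^ card J\<close> times
  its probability. A pointwise inequality between sign counts thus becomes one between
  probabilities.\<close>

lemma (in prob_space) measure_le_2_of_signs:
  fixes T :: "nat set \<Rightarrow> 'a \<Rightarrow> 'a"
  assumes J: "finite J"
    and T: "\<And>A. A \<subseteq> J \<Longrightarrow> T A \<in> M \<rightarrow>\<^sub>M M" "\<And>A. A \<subseteq> J \<Longrightarrow> distr M M (T A) = M"
    and E: "E \<in> events" "E' \<in> events"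
    and le: "\<And>\<omega>. \<omega> \<in> space M \<Longrightarrow>
      (\<Sum>A\<in>Pow J. of_bool (T A \<omega> \<in> E) :: real) \<le> 2 * (\<Sum>A\<in>Pow J. of_bool (T A \<omega> \<in> E'))"
  shows "prob E \<le> 2 * prob E'"
proof -
  have avg: "integrable M (\<lambda>\<omega>. \<Sum>A\<in>Pow J. of_bool (T A \<omega> \<in> F) :: real)"
    "2 ^ card J * prob F = (\<integral>\<omega>. (\<Sum>A\<in>Pow J. of_bool (T A \<omega> \<in> F)) \<partial>M)" if F: "F \<in> events" for F
  proof -
    have *: "integrable M (\<lambda>\<omega>. of_bool (T A \<omega> \<in> F) :: real)"
      "prob F = (\<integral>\<omega>. of_bool (T A \<omega> \<in> F) \<partial>M)" if "A \<subseteq> J" for A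
    proof -
      have TA [measurable]: "T A \<in> M \<rightarrow>\<^sub>M M" and [measurable]: "F \<in> sets M"
        using T(1)[OF that] F by auto
      show "integrable M (\<lambda>\<omega>. of_bool (T A \<omega> \<in> F) :: real)"
        by (intro integrable_const_bound[where B = 1]) (auto intro!: AE_I2)
      have "prob F = measure (distr M M (T A)) F"
        using T(2)[OF that] by simp
      also have "\<dots> = measure M (T A -` F \<inter> space M)"
        by (intro measure_distr) auto
      also have "\<dots> = (\<integral>\<omega>. indicator (T A -` F \<inter> space M) \<omega> \<partial>M)"
        by simp
      also have "\<dots> = (\<integral>\<omega>. of_bool (T A \<omega> \<in> F) \<partial>M)"
        by (intro Bochner_Integration.integral_cong) (auto simp: indicator_def)
      finally show "prob F = (\<integral>\<omega>. of_bool (T A \<omega> \<in> F) \<partial>M)" .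
    qed
    show "integrable M (\<lambda>\<omega>. \<Sum>A\<in>Pow J. of_bool (T A \<omega> \<in> F) :: real)"
      using * by (intro Bochner_Integration.integrable_sum) auto
    have "2 ^ card J * prob F = (\<Sum>A\<in>Pow J. prob F)"
      using J by (simp add: card_Pow)
    also have "\<dots> = (\<Sum>A\<in>Pow J. (\<integral>\<omega>. of_bool (T A \<omega> \<in> F) \<partial>M))"
      using *(2) by (intro sum.cong) auto
    also have "\<dots> = (\<integral>\<omega>. (\<Sum>A\<in>Pow J. of_bool (T A \<omega> \<in> F)) \<partial>M)"
      using *(1) by (intro Bochner_Integration.integral_sum[symmetric]) auto
    finally show "2 ^ card J * prob F = (\<integral>\<omega>. (\<Sum>A\<in>Pow J. of_bool (T A \<omega> \<in> F)) \<partial>M)" .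
  qed
  have "2 ^ card J * prob E \<le> (\<integral>\<omega>. 2 * (\<Sum>A\<in>Pow J. of_bool (T A \<omega> \<in> E')) \<partial>M)"
    unfolding avg(2)[OF E(1)]
    by (intro integral_mono avg E le integrable_mult_right)
  also have "\<dots> = 2 * (2 ^ card J * prob E')"
    unfolding avg(2)[OF E(2)] by simp
  finally show ?thesis by simp
qed

section \<open>Independent families and product measures\<close>

lemma (in prob_space) distr_PiM_indep:
  assumes "indep_vars (\<lambda>_. borel) Y L" "L \<noteq> {}" "\<And>i. i \<in> L \<Longrightarrow> distr M borel (Y i) = \<mu> i"
  shows "distr M (\<Pi>\<^sub>M i\<in>L. borel) (\<lambda>\<omega>. \<lambda>i\<in>L. Y i \<omega>) = (\<Pi>\<^sub>M i\<in>L. \<mu> i)"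
proof -
  have rv: "i \<in> L \<Longrightarrow> random_variable borel (Y i)" for i
    using assms(1) by (auto simp: indep_vars_def)
  have "distr M (\<Pi>\<^sub>M i\<in>L. borel) (\<lambda>\<omega>. \<lambda>i\<in>L. Y i \<omega>) = (\<Pi>\<^sub>M i\<in>L. distr M borel (Y i))"
    using indep_vars_iff_distr_eq_PiM'[where I = L and M' = "\<lambda>_. borel" and X = Y] assms(1,2) rv by simp
  also have "\<dots> = (\<Pi>\<^sub>M i\<in>L. \<mu> i)"
    using assms(3) by (intro PiM_cong) auto
  finally show ?thesis .
qed

lemma indep_vars_PiM_coordinates:
  fixes \<mu> :: "'i \<Rightarrow> 'a::topological_space measure"
  assumes "\<And>i. i \<in> L \<Longrightarrow> prob_space (\<mu> i)" "\<And>i. i \<in> L \<Longrightarrow> sets (\<mu> i) = sets borel" "L \<noteq> {}"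
  shows "prob_space.indep_vars (\<Pi>\<^sub>M i\<in>L. \<mu> i) (\<lambda>_. borel) (\<lambda>i \<omega>. \<omega> i) L"
proof -
  interpret prob_space "\<Pi>\<^sub>M i\<in>L. \<mu> i"
    by (intro prob_space_PiM assms)
  have meas: "random_variable borel (\<lambda>\<omega>. \<omega> i)" if "i \<in> L" for i
    using measurable_component_singleton[OF that, of \<mu>] measurable_cong_sets[OF refl assms(2)[OF that]]
    by blast
  have comp: "distr (\<Pi>\<^sub>M i\<in>L. \<mu> i) borel (\<lambda>\<omega>. \<omega> i) = \<mu> i" if "i \<in> L" for i
  proof -
    have "distr (\<Pi>\<^sub>M i\<in>L. \<mu> i) borel (\<lambda>\<omega>. \<omega> i) = distr (\<Pi>\<^sub>M i\<in>L. \<mu> i) (\<mu> i) (\<lambda>\<omega>. \<omega> i)"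
      using assms(2)[OF that] by (intro distr_cong) auto
    also have "\<dots> = \<mu> i"
      using assms(1) that by (rule distr_PiM_component)
    finally show ?thesis .
  qed
  have "distr (\<Pi>\<^sub>M i\<in>L. \<mu> i) (\<Pi>\<^sub>M i\<in>L. borel) (\<lambda>\<omega>. \<lambda>i\<in>L. \<omega> i) = distr (\<Pi>\<^sub>M i\<in>L. \<mu> i) (\<Pi>\<^sub>M i\<in>L. \<mu> i) (\<lambda>\<omega>. \<omega>)"
    using assms(2)
    by (intro distr_cong sets_PiM_cong) (auto simp: space_PiM PiE_def extensional_restrict)
  also have "\<dots> = (\<Pi>\<^sub>M i\<in>L. \<mu> i)"
    by simp
  also have "\<dots> = (\<Pi>\<^sub>M i\<in>L. distr (\<Pi>\<^sub>M i\<in>L. \<mu> i) borel (\<lambda>\<omega>. \<omega> i))"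
    using comp by (intro PiM_cong) auto
  finally show ?thesis
    using indep_vars_iff_distr_eq_PiM'[where I = L and M' = "\<lambda>_. borel" and X = "\<lambda>i \<omega>. \<omega> i"] assms(3) meas by simp
qed

text \<open>The canonical model of an i.i.d. sequence: the coordinates under \<open>P\<close>. The
  estimates concern joint laws only, so they are made there.\<close>

locale law_sequence = real_distribution \<mu> for \<mu> :: "real measure"
begin

abbreviation P :: "(nat \<Rightarrow> real) measure" where
  "P \<equiv> \<Pi>\<^sub>M _\<in>UNIV. \<mu>"

lemma prob_space_P: "prob_space P"
  by (intro prob_space_PiM prob_space_axioms)

sublocale P: prob_space P
  by (rule prob_space_P)

lemma sets_P [measurable_cong, simp]: "sets P = sets (\<Pi>\<^sub>M _\<in>UNIV. borel)"
  by (intro sets_PiM_cong) auto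

lemma space_P [simp]: "space P = UNIV"
  by (simp add: space_PiM)

lemma coordinate_measurable [measurable]: "(\<lambda>x. x j) \<in> borel_measurable P"
  by measurable

lemma indep_vars_coordinates: "P.indep_vars (\<lambda>_. borel) (\<lambda>j x. x j) UNIV"
  by (intro indep_vars_PiM_coordinates prob_space_axioms) auto

lemma distr_coordinate: "distr P borel (\<lambda>x. x j) = \<mu>"
proof -
  have "distr P borel (\<lambda>x. x j) = distr P \<mu> (\<lambda>x. x j)"
    by (intro distr_cong) auto
  then show ?thesis
    using distr_PiM_component[of UNIV "\<lambda>_. \<mu>" j] prob_space_axioms by simp
qed

lemma measure_coordinate:
  assumes [measurable]: "Measurable.pred borel Q"
  shows "P.prob {x. Q (x j)} = prob {x. Q x}"
proof -
  have "prob {x. Q x} = measure (distr P borel (\<lambda>x. x j)) {x. Q x}"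
    by (simp add: distr_coordinate)
  also have "\<dots> = P.prob {x. Q (x j)}"
    by (subst measure_distr) (auto simp: vimage_def)
  finally show ?thesis by simp
qed

end

locale symmetric_law = law_sequence +
  assumes distr_uminus: "distr \<mu> borel uminus = \<mu>"
begin

lemma flip_measurable [measurable]: "flip A \<in> P \<rightarrow>\<^sub>M P"
proof -
  have "flip A \<in> P \<rightarrow>\<^sub>M (\<Pi>\<^sub>M _\<in>UNIV. borel)"
    unfolding flip_def by (rule measurable_PiM_single') auto
  then show ?thesis by simp
qed

lemma distr_flip: "distr P P (flip A) = P"
proof -
  have "P.indep_vars (\<lambda>_. borel) (\<lambda>j x. (if j \<in> A then uminus else (\<lambda>r. r)) (x j)) UNIV"
    by (rule P.indep_vars_compose2[OF indep_vars_coordinates]) auto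
  moreover have "distr P borel (\<lambda>x. (if j \<in> A then uminus else (\<lambda>r. r)) (x j)) = \<mu>" for j
  proof -
    have "distr P borel (\<lambda>x. (if j \<in> A then uminus else (\<lambda>r. r)) (x j))
        = distr (distr P borel (\<lambda>x. x j)) borel (if j \<in> A then uminus else (\<lambda>r. r))"
      by (subst distr_distr) (auto simp: comp_def)
    also have "\<dots> = \<mu>"
      using distr_uminus by (auto simp: distr_coordinate distr_id2)
    finally show ?thesis .
  qed
  ultimately have "distr P (\<Pi>\<^sub>M _\<in>UNIV. borel) (\<lambda>x. \<lambda>j\<in>UNIV. (if j \<in> A then uminus else (\<lambda>r. r)) (x j)) = P"
    by (intro P.distr_PiM_indep) auto
  moreover have "distr P (\<Pi>\<^sub>M _\<in>UNIV. borel) (\<lambda>x. \<lambda>j\<in>UNIV. (if j \<in> A then uminus else (\<lambda>r. r)) (x j)) = distr P P (flip A)"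
    by (intro distr_cong) (auto simp: flip_def fun_eq_iff)
  ultimately show ?thesis by simp
qed

text \<open>For odd \<open>g\<close> and even \<open>\<alpha>\<close>, flipping the sample point
  flips the signs of the vectors and leaves the coefficients fixed. The sign inequality therefore
  applies at each point, although the coefficients are random.\<close>

lemma contraction:
  fixes g :: "nat \<Rightarrow> real \<Rightarrow> 'b::{banach, second_countable_topology}"
  assumes J: "finite J"
    and g [measurable]: "\<And>j. g j \<in> borel_measurable borel" and odd: "\<And>j r. g j (- r) = - g j r"
    and \<alpha> [measurable]: "\<And>j. \<alpha> j \<in> borel_measurable borel" and even: "\<And>j r. \<alpha> j (- r) = \<alpha> j r"
    and \<alpha>_bounds: "\<And>j r. j \<in> J \<Longrightarrow> 0 \<le> \<alpha> j r \<and> \<alpha> j r \<le> 1"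
  shows "P.prob {x. t < norm (\<Sum>j\<in>J. \<alpha> j (x j) *\<^sub>R g j (x j))} \<le> 2 * P.prob {x. t < norm (\<Sum>j\<in>J. g j (x j))}"
proof (rule P.measure_le_2_of_signs[OF J, where T = flip])
  have "{x \<in> space P. t < norm (\<Sum>j\<in>J. \<alpha> j (x j) *\<^sub>R g j (x j))} \<in> P.events"
    by measurable
  then show "{x. t < norm (\<Sum>j\<in>J. \<alpha> j (x j) *\<^sub>R g j (x j))} \<in> P.events" by simp
  have "{x \<in> space P. t < norm (\<Sum>j\<in>J. g j (x j))} \<in> P.events"
    by measurable
  then show "{x. t < norm (\<Sum>j\<in>J. g j (x j))} \<in> P.events" by simp
  have flip_g: "g j (flip A x j) = flip A (\<lambda>j. g j (x j)) j" for A x j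
    using odd by (simp add: flip_def)
  have "\<alpha> j (flip A x j) = \<alpha> j (x j)" for A x j
    using even by (simp add: flip_def)
  then show "(\<Sum>A\<in>Pow J. of_bool (flip A x \<in> {x. t < norm (\<Sum>j\<in>J. \<alpha> j (x j) *\<^sub>R g j (x j))}) :: real)
      \<le> 2 * (\<Sum>A\<in>Pow J. of_bool (flip A x \<in> {x. t < norm (\<Sum>j\<in>J. g j (x j))}))" for x
    using contraction_signs[of J "\<lambda>j. \<alpha> j (x j)" t "\<lambda>j. g j (x j)"] J \<alpha>_bounds
    by (simp add: flip_g)
qed (auto simp: distr_flip)

lemma Levy_inequality:
  fixes g :: "nat \<Rightarrow> real \<Rightarrow> 'b::{banach, second_countable_topology}"
  assumes "m \<le> n"
    and g [measurable]: "\<And>j. g j \<in> borel_measurable borel" and odd: "\<And>j r. g j (- r) = - g j r"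
  shows "P.prob {x. \<exists>k\<in>{m..n}. t < norm (\<Sum>j\<in>{m..<k}. g j (x j))} \<le> 2 * P.prob {x. t < norm (\<Sum>j\<in>{m..<n}. g j (x j))}"
proof (rule P.measure_le_2_of_signs[where T = flip and J = "{m..<n}"])
  have "{x \<in> space P. \<exists>k\<in>{m..n}. t < norm (\<Sum>j\<in>{m..<k}. g j (x j))} \<in> P.events"
    by measurable
  then show "{x. \<exists>k\<in>{m..n}. t < norm (\<Sum>j\<in>{m..<k}. g j (x j))} \<in> P.events" by simp
  have "{x \<in> space P. t < norm (\<Sum>j\<in>{m..<n}. g j (x j))} \<in> P.events"
    by measurable
  then show "{x. t < norm (\<Sum>j\<in>{m..<n}. g j (x j))} \<in> P.events" by simp
  have flip_g: "g j (flip A x j) = flip A (\<lambda>j. g j (x j)) j" for A x j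
    using odd by (simp add: flip_def)
  show "(\<Sum>A\<in>Pow {m..<n}. of_bool (flip A x \<in> {x. \<exists>k\<in>{m..n}. t < norm (\<Sum>j\<in>{m..<k}. g j (x j))}) :: real)
      \<le> 2 * (\<Sum>A\<in>Pow {m..<n}. of_bool (flip A x \<in> {x. t < norm (\<Sum>j\<in>{m..<n}. g j (x j))}))" for x
    using Levy_signs[of m n t 0 "\<lambda>j. g j (x j)"] assms(1)
    by (simp add: flip_g)
qed (auto simp: distr_flip)

end

section \<open>Almost sure convergence and stable laws\<close>

context symmetric_law
begin

text \<open>The hypothesis bounds each right end \<open>n\<close> separately. Levy's inequality
  bounds all right ends up to \<open>n\<close> at once, and continuity from below lets
  \<open>n\<close> grow, so the sums starting at a late \<open>m\<close> stay small almost
  surely.\<close>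

lemma AE_summable_of_Cauchy_in_prob:
  fixes w :: "nat \<Rightarrow> 'b::{banach, second_countable_topology}"
  assumes Cauchy: "\<And>\<epsilon>. 0 < \<epsilon> \<Longrightarrow> \<exists>m. \<forall>n\<ge>m. P.prob {x. \<epsilon> < norm (\<Sum>j\<in>{m..<n}. x j *\<^sub>R w j)} \<le> \<epsilon>"
  shows "AE x in P. summable (\<lambda>j. x j *\<^sub>R w j)"
proof -
  have null: "AE x in P. \<exists>m. \<forall>k\<ge>m. norm (\<Sum>j\<in>{m..<k}. x j *\<^sub>R w j) \<le> e" if "0 < e" for e
  proof -
    define D where "D = {x. \<forall>m. \<exists>k\<ge>m. e < norm (\<Sum>j\<in>{m..<k}. x j *\<^sub>R w j)}"
    have "{x \<in> space P. \<forall>m. \<exists>k\<ge>m. e < norm (\<Sum>j\<in>{m..<k}. x j *\<^sub>R w j)} \<in> P.events"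
      by measurable
    then have D: "D \<in> P.events" by (simp add: D_def)
    have "P.prob D \<le> 0"
    proof (rule field_le_epsilon)
      fix \<delta> :: real assume "0 < \<delta>"
      \<comment> \<open>The bound \<open>\<epsilon> \<le> e\<close> places \<open>D\<close> inside
        the union of the \<open>F n\<close>, and \<open>2 * \<epsilon> \<le> \<delta>\<close>
        absorbs the factor 2 of Levy's inequality.\<close>
      define \<epsilon> where "\<epsilon> = min e (\<delta> / 2)"
      have \<epsilon>: "0 < \<epsilon>" "\<epsilon> \<le> e" "2 * \<epsilon> \<le> \<delta>"
        using \<open>0 < e\<close> \<open>0 < \<delta>\<close> by (auto simp: \<epsilon>_def)
      obtain m where m: "\<And>n. n \<ge> m \<Longrightarrow> P.prob {x. \<epsilon> < norm (\<Sum>j\<in>{m..<n}. x j *\<^sub>R w j)} \<le> \<epsilon>"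
        using Cauchy[OF \<epsilon>(1)] by blast
      define F where "F n = {x. \<exists>k\<in>{m..n}. \<epsilon> < norm (\<Sum>j\<in>{m..<k}. x j *\<^sub>R w j)}" for n
      have F: "F n \<in> P.events" for n
      proof -
        have "{x \<in> space P. \<exists>k\<in>{m..n}. \<epsilon> < norm (\<Sum>j\<in>{m..<k}. x j *\<^sub>R w j)} \<in> P.events"
          by measurable
        then show ?thesis by (simp add: F_def)
      qed
      have "incseq F"
        unfolding F_def incseq_def by (fastforce intro: order_trans)
      have Fle: "P.prob (F n) \<le> \<delta>" for n
      proof (cases "m \<le> n")
        case True
        have "P.prob (F n) \<le> 2 * P.prob {x. \<epsilon> < norm (\<Sum>j\<in>{m..<n}. x j *\<^sub>R w j)}"
          unfolding F_def using Levy_inequality[OF True, of "\<lambda>j r. r *\<^sub>R w j" \<epsilon>] by simp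
        then show ?thesis using m[OF True] \<epsilon> by linarith
      next
        case False
        then have "F n = {}" by (auto simp: F_def)
        then show ?thesis using \<open>0 < \<delta>\<close> by simp
      qed
      have "(\<lambda>n. P.prob (F n)) \<longlonglongrightarrow> P.prob (\<Union>n. F n)"
        using F \<open>incseq F\<close> by (intro P.finite_Lim_measure_incseq) auto
      then have "P.prob (\<Union>n. F n) \<le> \<delta>"
        by (rule LIMSEQ_le_const2) (use Fle in auto)
      moreover have "D \<subseteq> (\<Union>n. F n)"
      proof
        fix x assume "x \<in> D"
        then obtain k where "k \<ge> m" "e < norm (\<Sum>j\<in>{m..<k}. x j *\<^sub>R w j)"
          by (auto simp: D_def)
        then have "x \<in> F k" using \<epsilon> by (auto simp: F_def intro!: bexI[of _ k])
        then show "x \<in> (\<Union>n. F n)" by blast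
      qed
      ultimately show "P.prob D \<le> 0 + \<delta>"
        using P.finite_measure_mono[of D "\<Union>n. F n"] sets.countable_UN[of F UNIV P] F by auto
    qed
    then have "P.prob D = 0"
      by (simp add: measure_le_0_iff)
    then have "AE x in P. x \<notin> D"
      using P.prob_eq_0[OF D] by blast
    then show ?thesis
      by eventually_elim (force simp: D_def not_less)
  qed
  have "AE x in P. \<forall>n. \<exists>m. \<forall>k\<ge>m. norm (\<Sum>j\<in>{m..<k}. x j *\<^sub>R w j) \<le> inverse (real (Suc n))"
    by (subst AE_all_countable) (auto intro: null)
  then show ?thesis
  proof eventually_elim
    case (elim x)
    show "summable (\<lambda>j. x j *\<^sub>R w j)"
      unfolding summable_Cauchy
    proof (intro allI impI)
      fix e :: real assume "0 < e"
      then obtain n where n: "inverse (real (Suc n)) < e / 2"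
        using reals_Archimedean[of "e / 2"] by auto
      obtain N where N: "\<And>k. k \<ge> N \<Longrightarrow> norm (\<Sum>j\<in>{N..<k}. x j *\<^sub>R w j) \<le> inverse (real (Suc n))"
        using elim by blast
      have "norm (\<Sum>j\<in>{a..<b}. x j *\<^sub>R w j) < e" if "a \<ge> N" for a b
      proof (cases "a \<le> b")
        case True
        have "(\<Sum>j\<in>{a..<b}. x j *\<^sub>R w j) = (\<Sum>j\<in>{N..<b}. x j *\<^sub>R w j) - (\<Sum>j\<in>{N..<a}. x j *\<^sub>R w j)"
          using sum.atLeastLessThan_concat[OF that True, of "\<lambda>j. x j *\<^sub>R w j"] by (simp add: algebra_simps)
        then show ?thesis
          using N[of a] N[of b] that True n
            norm_triangle_ineq4[of "\<Sum>j\<in>{N..<b}. x j *\<^sub>R w j" "\<Sum>j\<in>{N..<a}. x j *\<^sub>R w j"] by force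
      qed (use \<open>0 < e\<close> in auto)
      then show "\<exists>N. \<forall>m\<ge>N. \<forall>n. norm (\<Sum>j\<in>{m..<n}. x j *\<^sub>R w j) < e" by blast
    qed
  qed
qed

end

section \<open>Strict stability and tails of stable laws\<close>

lemma char_distr_scale:
  fixes c :: real
  assumes [measurable]: "X \<in> borel_measurable M"
  shows "char (distr M borel (\<lambda>\<omega>. c * X \<omega>)) t = char (distr M borel X) (c * t)"
  by (simp add: char_def integral_distr mult_ac)

locale stable_law = real_distribution \<mu> for \<mu> :: "real measure" and p :: real +
  assumes p_pos: "0 < p"
    and char_eq: "\<And>t. char \<mu> t = of_real (exp (- (\<bar>t\<bar> powr p)))"

sublocale stable_law \<subseteq> symmetric_law
proof
  have "char (distr \<mu> borel uminus) = char \<mu>"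
  proof
    fix t
    have "char (distr \<mu> borel uminus) t = char (distr \<mu> borel (\<lambda>r. r)) (- t)"
      using char_distr_scale[of "\<lambda>r. r" \<mu> "- 1" t] by simp
    also have "distr \<mu> borel (\<lambda>r. r) = \<mu>"
      by (rule distr_id2) simp
    finally show "char (distr \<mu> borel uminus) t = char \<mu> t"
      by (simp add: char_eq)
  qed
  moreover have "real_distribution (distr \<mu> borel uminus)"
    by (intro real_distribution_distr) auto
  ultimately show "distr \<mu> borel uminus = \<mu>"
    using real_distribution_axioms by (intro Levy_uniqueness) auto
qed

context stable_law
begin

text \<open>Strict stability: for N = \<open>card J\<close> the sum has characteristic function
  exp(-N |t|^p), and rescaling by N^(-1/p) removes the factor N.\<close>

lemma distr_scaled_sum:
  assumes "finite J" "J \<noteq> {}"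
  shows "distr P borel (\<lambda>x. real (card J) powr (- 1 / p) * (\<Sum>j\<in>J. x j)) = \<mu>"
proof -
  let ?c = "real (card J) powr (- 1 / p)"
  have pos: "0 < real (card J)" using assms by (simp add: card_gt_0_iff)
  have "char (distr P borel (\<lambda>x. ?c * (\<Sum>j\<in>J. x j))) = char \<mu>"
  proof
    fix t
    have "char (distr P borel (\<lambda>x. ?c * (\<Sum>j\<in>J. x j))) t = char (distr P borel (\<lambda>x. \<Sum>j\<in>J. x j)) (?c * t)"
      by (rule char_distr_scale) measurable
    also have "\<dots> = (\<Prod>j\<in>J. char (distr P borel (\<lambda>x. x j)) (?c * t))"
      by (intro P.char_distr_sum P.indep_vars_subset[OF indep_vars_coordinates]) auto
    also have "\<dots> = of_real (exp (- (\<bar>?c * t\<bar> powr p)) ^ card J)"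
      by (simp add: distr_coordinate char_eq)
    also have "exp (- (\<bar>?c * t\<bar> powr p)) ^ card J = exp (- (real (card J) * \<bar>?c * t\<bar> powr p))"
      by (simp add: exp_of_nat_mult[symmetric])
    also have "real (card J) * \<bar>?c * t\<bar> powr p = \<bar>t\<bar> powr p"
      using pos p_pos by (simp add: abs_mult powr_divide powr_powr powr_minus field_simps)
    finally show "char (distr P borel (\<lambda>x. ?c * (\<Sum>j\<in>J. x j))) t = char \<mu> t"
      by (simp add: char_eq)
  qed
  moreover have "real_distribution (distr P borel (\<lambda>x. ?c * (\<Sum>j\<in>J. x j)))"
    by (intro P.real_distribution_distr) measurable
  ultimately show ?thesis
    using real_distribution_axioms by (intro Levy_uniqueness) auto
qed

text \<open>Terms with the same value \<open>l\<close> of \<open>i\<close> are collected. By strict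
  stability the coordinates of a group add up to a copy of \<open>x l\<close> times the 1/p-th power
  of the group size. Disjoint groups are independent, so the joint laws agree.\<close>

lemma prob_grouped_sum:
  fixes u :: "nat \<Rightarrow> 'b::{banach, second_countable_topology}" and i :: "nat \<Rightarrow> nat"
  assumes J: "finite J" and B: "finite B" "\<And>l. l \<in> B \<Longrightarrow> {j \<in> J. i j = l} \<noteq> {}"
  shows "P.prob {x. t < norm (\<Sum>j\<in>{j \<in> J. i j \<in> B}. x j *\<^sub>R u (i j))} =
    P.prob {x. t < norm (\<Sum>l\<in>B. (real (card {j \<in> J. i j = l}) powr (1 / p) * x l) *\<^sub>R u l)}"
proof (cases "B = {}")
  case True
  then show ?thesis by simp
next
  case False
  let ?K = "\<lambda>l. {j \<in> J. i j = l}"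
  let ?N = "\<lambda>l. real (card (?K l))"
  define Y where "Y l x = ?N l powr (- 1 / p) * (\<Sum>j\<in>?K l. x j)" for l and x :: "nat \<Rightarrow> real"
  define Q where "Q = (\<lambda>z. t < norm (\<Sum>l\<in>B. (?N l powr (1 / p) * z l) *\<^sub>R u l))"
  have Q [measurable]: "Measurable.pred (\<Pi>\<^sub>M l\<in>B. borel) Q"
    unfolding Q_def by measurable
  have N_pos: "0 < ?N l" if "l \<in> B" for l
    using B(2)[OF that] J by (simp add: card_gt_0_iff)
  have Y_meas: "Y l \<in> borel_measurable P" for l
    unfolding Y_def by measurable
  have "P.indep_vars (\<lambda>l. PiM (?K l) (\<lambda>_. borel)) (\<lambda>l x. restrict (\<lambda>j. x j) (?K l)) B"
    by (rule P.indep_vars_restrict[OF indep_vars_coordinates]) (auto simp: disjoint_family_on_def)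
  then have "P.indep_vars (\<lambda>_. borel) (\<lambda>l x. ?N l powr (- 1 / p) * (\<Sum>j\<in>?K l. restrict (\<lambda>j. x j) (?K l) j)) B"
    by (rule P.indep_vars_compose2) measurable
  then have indep: "P.indep_vars (\<lambda>_. borel) Y B"
    unfolding Y_def by (rule P.indep_vars_cong[THEN iffD1, rotated -1]) auto
  have "distr P (\<Pi>\<^sub>M l\<in>B. borel) (\<lambda>x. \<lambda>l\<in>B. Y l x) = (\<Pi>\<^sub>M l\<in>B. \<mu>)"
    using indep B J False unfolding Y_def
    by (intro P.distr_PiM_indep distr_scaled_sum) auto
  moreover have "distr P (\<Pi>\<^sub>M l\<in>B. borel) (\<lambda>x. \<lambda>l\<in>B. x l) = (\<Pi>\<^sub>M l\<in>B. \<mu>)"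
    using False by (intro P.distr_PiM_indep P.indep_vars_subset[OF indep_vars_coordinates])
      (auto simp: distr_coordinate)
  ultimately have eq: "distr P (\<Pi>\<^sub>M l\<in>B. borel) (\<lambda>x. \<lambda>l\<in>B. Y l x) = distr P (\<Pi>\<^sub>M l\<in>B. borel) (\<lambda>x. \<lambda>l\<in>B. x l)"
    by simp
  have prob: "measure (distr P (\<Pi>\<^sub>M l\<in>B. borel) (\<lambda>x. \<lambda>l\<in>B. Z l x)) {z \<in> space (\<Pi>\<^sub>M l\<in>B. borel). Q z}
      = P.prob {x. Q (\<lambda>l\<in>B. Z l x)}" if "\<And>l. Z l \<in> borel_measurable P" for Z
  proof (subst measure_distr)
    show "(\<lambda>x. \<lambda>l\<in>B. Z l x) \<in> P \<rightarrow>\<^sub>M (\<Pi>\<^sub>M l\<in>B. borel)"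
      using that by (intro measurable_restrict)
    show "P.prob ((\<lambda>x. \<lambda>l\<in>B. Z l x) -` {z \<in> space (\<Pi>\<^sub>M l\<in>B. borel). Q z} \<inter> space P) = P.prob {x. Q (\<lambda>l\<in>B. Z l x)}"
      by (intro arg_cong[where f = P.prob]) (auto simp: space_PiM)
  qed measurable
  have sum_eq: "(\<Sum>j\<in>{j \<in> J. i j \<in> B}. x j *\<^sub>R u (i j)) = (\<Sum>l\<in>B. (?N l powr (1 / p) * Y l x) *\<^sub>R u l)" for x
  proof -
    have "(\<Sum>j\<in>{j \<in> J. i j \<in> B}. x j *\<^sub>R u (i j)) = (\<Sum>l\<in>B. \<Sum>j\<in>{j \<in> {j \<in> J. i j \<in> B}. i j = l}. x j *\<^sub>R u (i j))"
      using J B by (intro sum.group[symmetric]) auto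
    also have "\<dots> = (\<Sum>l\<in>B. (?N l powr (1 / p) * Y l x) *\<^sub>R u l)"
    proof (intro sum.cong refl)
      fix l assume l: "l \<in> B"
      have "(\<Sum>j\<in>{j \<in> {j \<in> J. i j \<in> B}. i j = l}. x j *\<^sub>R u (i j)) = (\<Sum>j\<in>?K l. x j) *\<^sub>R u l"
        unfolding scaleR_sum_left using l by (intro sum.cong) auto
      also have "(\<Sum>j\<in>?K l. x j) = ?N l powr (1 / p) * Y l x"
        using N_pos[OF l] by (simp add: Y_def powr_minus)
      finally show "(\<Sum>j\<in>{j \<in> {j \<in> J. i j \<in> B}. i j = l}. x j *\<^sub>R u (i j)) = (?N l powr (1 / p) * Y l x) *\<^sub>R u l" .
    qed
    finally show ?thesis .
  qed
  have "P.prob {x. t < norm (\<Sum>j\<in>{j \<in> J. i j \<in> B}. x j *\<^sub>R u (i j))} = P.prob {x. Q (\<lambda>l\<in>B. Y l x)}"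
    by (simp add: sum_eq Q_def)
  also have "\<dots> = P.prob {x. Q (\<lambda>l\<in>B. x l)}"
    using prob[of Y] prob[of "\<lambda>l x. x l"] Y_meas eq by simp
  finally show ?thesis
    by (simp add: Q_def)
qed

text \<open>By strict stability the sum of \<open>n\<close> coordinates exceeds a multiple of
  n^(1/p) with the same small probability for every \<open>n\<close>. Levy's inequality extends this
  to all partial sums, hence to the largest coordinate, and independence turns it into a bound on
  \<open>n\<close> times a single tail.\<close>

lemma tail_bound:
  assumes "0 < \<kappa>"
  shows "\<exists>c>0. \<forall>n\<ge>1. real n * prob {r. c * real n powr (1 / p) < \<bar>r\<bar>} \<le> \<kappa>"
proof -
  \<comment> \<open>The bound 1/4 makes \<open>1 - 2 * \<theta>\<close> at least 1/2, which yields
    \<open>real n * \<pi> \<le> 4 * \<theta>\<close> at the end.\<close>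
  define \<theta> where "\<theta> = min (1 / 4) (\<kappa> / 4)"
  have \<theta>: "0 < \<theta>" "\<theta> \<le> 1 / 4" "4 * \<theta> \<le> \<kappa>"
    using assms by (auto simp: \<theta>_def)
  have "(\<lambda>n. prob {r. real n < \<bar>r\<bar>}) \<longlonglongrightarrow> prob (\<Inter>n. {r. real n < \<bar>r\<bar>})"
    by (intro finite_Lim_measure_decseq) (auto simp: decseq_def)
  moreover have "(\<Inter>n. {r. real n < \<bar>r\<bar>}) = {}"
  proof -
    have "\<exists>n. \<not> real n < \<bar>r\<bar>" for r :: real
      using real_arch_simple[of "\<bar>r\<bar>"] by (auto simp: not_less)
    then show ?thesis by auto
  qed
  ultimately have "(\<lambda>n. prob {r. real n < \<bar>r\<bar>}) \<longlonglongrightarrow> 0" by simp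
  then have "eventually (\<lambda>n. prob {r. real n < \<bar>r\<bar>} < \<theta> \<and> 0 < n) sequentially"
    by (intro eventually_conj order_tendstoD(2)[OF _ \<theta>(1)] eventually_gt_at_top)
  then obtain s :: nat where s: "prob {r. real s < \<bar>r\<bar>} < \<theta>" "0 < s"
    using eventually_happens'[OF sequentially_bot] by blast
  have "real n * prob {r. 2 * real s * real n powr (1 / p) < \<bar>r\<bar>} \<le> \<kappa>" if "n \<ge> 1" for n
  proof -
    define \<pi> where "\<pi> = prob {r. 2 * real s * real n powr (1 / p) < \<bar>r\<bar>}"
    define \<rho> where "\<rho> = real s * real n powr (1 / p)"
    have n: "0 < real n" using that by simp
    have "P.prob {x. \<rho> < \<bar>\<Sum>j<n. x j\<bar>} = P.prob {x. real s < \<bar>real n powr (- 1 / p) * (\<Sum>j<n. x j)\<bar>}"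
    proof -
      have "\<rho> < \<bar>y\<bar> \<longleftrightarrow> real s < \<bar>real n powr (- 1 / p) * y\<bar>" for y
      proof -
        have "\<bar>real n powr (- 1 / p) * y\<bar> = \<bar>y\<bar> / real n powr (1 / p)"
          by (simp add: abs_mult powr_minus_divide)
        then show ?thesis
          using n by (simp add: \<rho>_def pos_less_divide_eq)
      qed
      then show ?thesis by simp
    qed
    also have "\<dots> = measure (distr P borel (\<lambda>x. real n powr (- 1 / p) * (\<Sum>j<n. x j))) {r. real s < \<bar>r\<bar>}"
      by (subst measure_distr) (auto simp: vimage_def)
    also have "\<dots> = prob {r. real s < \<bar>r\<bar>}"
      using distr_scaled_sum[of "{..<n}"] that by (simp add: lessThan_empty_iff)
    finally have sum_n: "P.prob {x. \<rho> < \<bar>\<Sum>j<n. x j\<bar>} < \<theta>"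
      using s by simp
    define E where "E = (\<Inter>j\<in>{..<n}. (\<lambda>x. x j) -` {r. \<bar>r\<bar> \<le> 2 * \<rho>} \<inter> space P)"
    have "{x \<in> space P. \<forall>j\<in>{..<n}. \<bar>x j\<bar> \<le> 2 * \<rho>} \<in> P.events"
      by measurable
    moreover have "{x \<in> space P. \<forall>j\<in>{..<n}. \<bar>x j\<bar> \<le> 2 * \<rho>} = E"
      using that by (auto simp: E_def)
    ultimately have E_meas: "E \<in> P.events" by simp
    have "P.prob E = (\<Prod>j\<in>{..<n}. P.prob ((\<lambda>x. x j) -` {r. \<bar>r\<bar> \<le> 2 * \<rho>} \<inter> space P))"
      unfolding E_def using that
      by (intro P.indep_varsD_finite[OF P.indep_vars_subset[OF indep_vars_coordinates]]) (auto simp: lessThan_empty_iff)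
    also have "\<dots> = (1 - \<pi>) ^ n"
    proof -
      have "P.prob ((\<lambda>x. x j) -` {r. \<bar>r\<bar> \<le> 2 * \<rho>} \<inter> space P) = 1 - \<pi>" for j
      proof -
        have "P.prob ((\<lambda>x. x j) -` {r. \<bar>r\<bar> \<le> 2 * \<rho>} \<inter> space P) = prob {r. \<bar>r\<bar> \<le> 2 * \<rho>}"
          using measure_coordinate[of "\<lambda>r. \<bar>r\<bar> \<le> 2 * \<rho>" j] by (simp add: vimage_def)
        also have "\<dots> = prob (space \<mu> - {r. 2 * \<rho> < \<bar>r\<bar>})"
          by (intro arg_cong[where f = prob]) auto
        also have "\<dots> = 1 - \<pi>"
          by (subst prob_compl) (auto simp: \<pi>_def \<rho>_def mult.assoc)
        finally show ?thesis .
      qed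
      then show ?thesis by simp
    qed
    finally have prob_E: "P.prob E = (1 - \<pi>) ^ n" .
    have "1 - P.prob E = P.prob (space P - E)"
      using P.prob_compl[OF E_meas] by simp
    also have "\<dots> \<le> P.prob {x. \<exists>k\<in>{0..n}. \<rho> < norm (\<Sum>j\<in>{0..<k}. x j)}"
    proof (rule P.finite_measure_mono)
      have "{x \<in> space P. \<exists>k\<in>{0..n}. \<rho> < norm (\<Sum>j\<in>{0..<k}. x j)} \<in> P.events"
        by measurable
      then show "{x. \<exists>k\<in>{0..n}. \<rho> < norm (\<Sum>j\<in>{0..<k}. x j)} \<in> P.events" by simp
      show "space P - E \<subseteq> {x. \<exists>k\<in>{0..n}. \<rho> < norm (\<Sum>j\<in>{0..<k}. x j)}"
      proof
        fix x assume "x \<in> space P - E"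
        then obtain j where j: "j < n" "2 * \<rho> < \<bar>x j\<bar>"
          by (auto simp: E_def not_le)
        \<comment> \<open>A coordinate is the difference of two consecutive partial sums; hence the
          factor 2 in the threshold \<open>2 * \<rho>\<close>.\<close>
        have "\<rho> < \<bar>\<Sum>j\<in>{0..<Suc j}. x j\<bar> \<or> \<rho> < \<bar>\<Sum>j\<in>{0..<j}. x j\<bar>"
          using j(2) by auto
        then show "x \<in> {x. \<exists>k\<in>{0..n}. \<rho> < norm (\<Sum>j\<in>{0..<k}. x j)}"
          using j(1) by (auto intro: bexI[of _ j] bexI[of _ "Suc j"])
      qed
    qed
    also have "\<dots> \<le> 2 * P.prob {x. \<rho> < norm (\<Sum>j\<in>{0..<n}. x j)}"
      using Levy_inequality[of 0 n "\<lambda>_ r. r" \<rho>] by simp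
    also have "\<dots> \<le> 2 * \<theta>"
      using sum_n by (simp add: atLeast0LessThan)
    finally have "1 - 2 * \<theta> \<le> (1 - \<pi>) ^ n"
      by (simp add: prob_E)
    also have "\<dots> \<le> exp (- \<pi>) ^ n"
      using exp_ge_add_one_self[of "- \<pi>"] by (intro power_mono) (auto simp: \<pi>_def)
    also have "\<dots> = exp (- (real n * \<pi>))"
      by (simp add: exp_of_nat_mult[symmetric])
    finally have *: "(1 - 2 * \<theta>) * exp (real n * \<pi>) \<le> 1"
      by (simp add: exp_minus field_simps)
    have "(1 - 2 * \<theta>) * (1 + real n * \<pi>) \<le> (1 - 2 * \<theta>) * exp (real n * \<pi>)"
      using \<theta> by (intro mult_left_mono exp_ge_add_one_self) auto
    also note *
    finally have "(1 - 2 * \<theta>) * (1 + real n * \<pi>) \<le> 1" .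
    moreover have "(1 - 2 * \<theta>) * (real n * \<pi>) \<ge> (1 / 2) * (real n * \<pi>)"
      using \<theta> by (intro mult_right_mono) (auto simp: \<pi>_def)
    ultimately have "real n * \<pi> \<le> 4 * \<theta>"
      by (simp add: algebra_simps)
    then show ?thesis
      using \<theta> by (simp add: \<pi>_def)
  qed
  then show ?thesis
    using s by (intro exI[of _ "2 * real s"]) auto
qed

end

section \<open>Comparison of the truncated variables with stable sums\<close>

lemma card_Collect_eq_sum:
  "real (card {j \<in> {1..n :: nat}. Q j}) = (\<Sum>j\<in>{1..n}. of_bool (Q j))"
  unfolding of_bool_def by (subst sum.inter_filter[symmetric]) auto

lemma (in law_sequence) count_measurable [measurable]:
  fixes h :: "real \<Rightarrow> nat"
  assumes [measurable]: "h \<in> borel \<rightarrow>\<^sub>M count_space UNIV"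
  shows "(\<lambda>y. real (card {j \<in> {1..n}. h (y j) = l})) \<in> borel_measurable P"
  unfolding card_Collect_eq_sum by measurable

text \<open>Hoeffding's inequality for the indicators, at a deviation of half the mean, bounds each
  failure probability by a geometric sequence, with ratio below 1 because the index has positive
  probability. A union bound over the finite set \<open>B\<close> finishes.\<close>

lemma (in law_sequence) large_counts:
  fixes h :: "real \<Rightarrow> nat"
  assumes h [measurable]: "h \<in> borel \<rightarrow>\<^sub>M count_space UNIV"
    and B: "finite B" "\<And>l. l \<in> B \<Longrightarrow> 0 < prob {r. h r = l}"
  shows "\<exists>n\<ge>k. 1 / 2 \<le> P.prob {y. \<forall>l\<in>B. real n * prob {r. h r = l} / 2 \<le> real (card {j \<in> {1..n}. h (y j) = l})}"
proof -
  let ?q = "\<lambda>l. prob {r. h r = l}"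
  let ?N = "\<lambda>n y l. real (card {j \<in> {1..n::nat}. h (y j) = l})"
  have few: "P.prob {y \<in> space P. ?N n y l \<le> real n * ?q l / 2} \<le> exp (- (?q l)\<^sup>2 / 2) ^ n"
    if "0 < n" for n l
  proof -
    interpret H: Hoeffding_ineq_iid P "{1..n}" "\<lambda>j y. of_bool (h (y j) = l)" "\<lambda>y. of_bool (h (y 0) = l)" 0 1
      "P.expectation (\<lambda>y. of_bool (h (y 0) = l))"
    proof unfold_locales
      show "P.indep_vars (\<lambda>_. borel) (\<lambda>j y. of_bool (h (y j) = l) :: real) {1..n}"
        by (rule P.indep_vars_compose2[OF P.indep_vars_subset[OF indep_vars_coordinates]]) auto
      fix j
      have "distr P borel (\<lambda>y. of_bool (h (y j) = l) :: real) = distr \<mu> borel (\<lambda>r. of_bool (h r = l))" for j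
        by (subst distr_coordinate[of j, symmetric], subst distr_distr) (auto simp: comp_def)
      then show "distr P borel (\<lambda>y. of_bool (h (y j) = l) :: real) = distr P borel (\<lambda>y. of_bool (h (y 0) = l))"
        by simp
    qed (auto intro!: AE_I2)
    have q: "P.expectation (\<lambda>y. of_bool (h (y 0) = l)) = ?q l"
    proof -
      have "P.expectation (\<lambda>y. of_bool (h (y 0) = l)) = P.expectation (indicator {y. h (y 0) = l})"
        by (intro Bochner_Integration.integral_cong) (auto simp: indicator_def)
      also have "\<dots> = ?q l"
        using measure_coordinate[of "\<lambda>r. h r = l" 0] by simp
      finally show ?thesis .
    qed
    have "P.prob {y \<in> space P. ?N n y l \<le> real n * ?q l / 2}
        = P.prob {y \<in> space P. (\<Sum>j\<in>{1..n}. of_bool (h (y j) = l)) \<le> real (card {1..n}) * ?q l - real n * ?q l / 2}"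
      unfolding card_Collect_eq_sum by simp
    also have "\<dots> \<le> exp (- 2 * (real n * ?q l / 2)\<^sup>2 / (real (card {1..n}) * (1 - 0)\<^sup>2))"
      using that H.Hoeffding_ineq_le[of "real n * ?q l / 2"] unfolding q by simp
    also have "- 2 * (real n * ?q l / 2)\<^sup>2 / (real (card {1..n}) * (1 - 0)\<^sup>2) = real n * (- (?q l)\<^sup>2 / 2)"
      using that by (simp add: power2_eq_square field_simps)
    also have "exp (real n * (- (?q l)\<^sup>2 / 2)) = exp (- (?q l)\<^sup>2 / 2) ^ n"
      by (rule exp_of_nat_mult)
    finally show ?thesis .
  qed
  have "(\<lambda>n. \<Sum>l\<in>B. exp (- (?q l)\<^sup>2 / 2) ^ n) \<longlonglongrightarrow> (\<Sum>l\<in>B. 0)"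
    using B(2)[THEN less_imp_neq] by (intro tendsto_sum LIMSEQ_power_zero) auto
  then have "eventually (\<lambda>n. (\<Sum>l\<in>B. exp (- (?q l)\<^sup>2 / 2) ^ n) < 1 / 2 \<and> k < n) sequentially"
    by (intro eventually_conj order_tendstoD eventually_gt_at_top) auto
  then obtain n where n: "(\<Sum>l\<in>B. exp (- (?q l)\<^sup>2 / 2) ^ n) < 1 / 2" "k < n"
    using eventually_happens'[OF sequentially_bot] by blast
  let ?G = "{y \<in> space P. \<forall>l\<in>B. real n * ?q l / 2 \<le> ?N n y l}"
  have G: "?G \<in> P.events"
    using B(1) by measurable
  have few_meas: "{y \<in> space P. ?N n y l \<le> real n * ?q l / 2} \<in> P.events" for l
    by measurable
  have "1 - P.prob ?G = P.prob (space P - ?G)"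
    using P.prob_compl[OF G] by simp
  also have "\<dots> \<le> P.prob (\<Union>l\<in>B. {y \<in> space P. ?N n y l \<le> real n * ?q l / 2})"
    using B(1) few_meas by (intro P.finite_measure_mono sets.finite_UN) auto
  also have "\<dots> \<le> (\<Sum>l\<in>B. P.prob {y \<in> space P. ?N n y l \<le> real n * ?q l / 2})"
    using B(1) few_meas by (intro P.finite_measure_subadditive_finite) auto
  also have "\<dots> \<le> (\<Sum>l\<in>B. exp (- (?q l)\<^sup>2 / 2) ^ n)"
    using n by (intro sum_mono few) auto
  finally show ?thesis
    using n by (intro exI[of _ n]) auto
qed

text \<open>For positive \<open>p\<close> and \<open>c\<close> this is the least \<open>n\<close>
  with \<open>\<bar>r\<bar> \<le> c * real n powr (1 / p)\<close>.\<close>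

definition level :: "real \<Rightarrow> real \<Rightarrow> real \<Rightarrow> nat" where
  "level p c r = nat \<lceil>(\<bar>r\<bar> / c) powr p\<rceil>"

lemma level_measurable [measurable]: "level p c \<in> borel \<rightarrow>\<^sub>M count_space UNIV"
  unfolding level_def by measurable

lemma level_uminus [simp]: "level p c (- r) = level p c r"
  by (simp add: level_def)

lemma level_le_iff:
  assumes "0 < p" "0 < c"
  shows "level p c r \<le> n \<longleftrightarrow> \<bar>r\<bar> \<le> c * real n powr (1 / p)"
proof -
  have "level p c r \<le> n \<longleftrightarrow> (\<bar>r\<bar> / c) powr p \<le> real n"
    by (simp add: level_def nat_le_iff ceiling_le_iff)
  also have "\<dots> \<longleftrightarrow> ((\<bar>r\<bar> / c) powr p) powr (1 / p) \<le> real n powr (1 / p)"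
  proof
    show "((\<bar>r\<bar> / c) powr p) powr (1 / p) \<le> real n powr (1 / p)" if "(\<bar>r\<bar> / c) powr p \<le> real n"
      using that assms by (intro powr_mono2) auto
    show "(\<bar>r\<bar> / c) powr p \<le> real n" if "((\<bar>r\<bar> / c) powr p) powr (1 / p) \<le> real n powr (1 / p)"
      using that assms powr_less_mono2[of "1 / p" "real n" "(\<bar>r\<bar> / c) powr p"] by fastforce
  qed
  also have "((\<bar>r\<bar> / c) powr p) powr (1 / p) = \<bar>r\<bar> / c"
    using assms by (simp add: powr_powr)
  finally show ?thesis
    using assms by (simp add: pos_divide_le_eq mult.commute)
qed

lemma level_pos:
  assumes "0 < p" "0 < c" "r \<noteq> 0"
  shows "1 \<le> level p c r"
  \<comment> \<open>Level 0 would force \<open>r = 0\<close>, because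
    \<open>0 powr (1 / p) = 0\<close>.\<close>
  using level_le_iff[OF assms(1,2), of r 0] assms(1,3) by (cases "level p c r") auto

text \<open>
  A stable value \<open>r\<close> with \<open>\<bar>r\<bar>\<close> of order \<open>n powr (1 / p)\<close> is mapped to a vector of norm \<open>a n\<close>, which moves the
  tails from the scale \<open>n powr (1 / p)\<close> to the scale \<open>a\<close>.
\<close>

definition truncated_rv ::
  "(nat \<Rightarrow> real) \<Rightarrow> real \<Rightarrow> real \<Rightarrow> (nat \<Rightarrow> nat) \<Rightarrow> (nat \<Rightarrow> 'b::real_vector) \<Rightarrow> real \<Rightarrow> nat \<Rightarrow> 'b" where
  "truncated_rv a p c T u r l =
     (if level p c r \<le> T l then (a (level p c r) * sgn r) *\<^sub>R u l else 0)"

lemma truncated_rv_uminus: "truncated_rv a p c T u (- r) l = - truncated_rv a p c T u r l"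
  by (simp add: truncated_rv_def sgn_minus)

lemma truncated_rv_measurable [measurable]:
  fixes u :: "nat \<Rightarrow> 'b::{banach, second_countable_topology}"
  shows "(\<lambda>r. truncated_rv a p c T u r l) \<in> borel_measurable borel"
  unfolding truncated_rv_def by measurable

text \<open>A nonzero value has norm at most \<open>a\<close> at its level, so strict monotonicity
  of \<open>a\<close> turns an excess over \<open>a n\<close> into a level above \<open>n\<close>.
  The two resulting conditions concern \<open>r\<close> and \<open>l\<close> separately, so the tail
  bound factorises when these are independent.\<close>

lemma norm_truncated_rv_gt:
  assumes "0 < p" "0 < c" "1 \<le> n" and a: "strict_mono_on {1..} a" "\<And>n. n \<ge> 1 \<Longrightarrow> 0 < a n"
    and u: "norm (u l) \<le> 1" and gt: "a n < norm (truncated_rv a p c T u r l)"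
  shows "c * real n powr (1 / p) < \<bar>r\<bar> \<and> n < T l"
proof -
  let ?m = "level p c r"
  have "r \<noteq> 0" "?m \<le> T l"
    using gt a(2)[OF assms(3)] by (auto simp: truncated_rv_def split: if_splits)
  have m: "1 \<le> ?m"
    using level_pos assms(1,2) \<open>r \<noteq> 0\<close> by blast
  have "norm (truncated_rv a p c T u r l) \<le> a ?m * 1"
    using \<open>?m \<le> T l\<close> \<open>r \<noteq> 0\<close> a(2)[OF m] u
    by (auto simp: truncated_rv_def abs_mult abs_sgn_eq)
  then have "a n < a ?m" using gt by simp
  then have "n < ?m"
    using strict_mono_on_leD[OF a(1), of ?m n] m assms(3) by force
  then show ?thesis
    using \<open>?m \<le> T l\<close> level_le_iff[OF assms(1,2), of r n] by auto
qed

section \<open>Contraction estimates along a fixed index sequence\<close>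

context stable_law
begin

text \<open>While no \<open>\<bar>x j\<bar>\<close> exceeds \<open>c * real n powr (1 / p)\<close>,
  the stable summands from \<open>B\<close> are, up to a common factor, truncated ones times even
  coefficients in [0,1], so contraction applies. The last term pays for samples with a larger
  coordinate.\<close>

lemma prob_le_prob_truncated:
  fixes u :: "nat \<Rightarrow> 'b::{banach, second_countable_topology}" and i :: "nat \<Rightarrow> nat"
  assumes c: "0 < c" and n: "1 \<le> n" and J: "finite J"
    and a: "\<And>n. n \<ge> 1 \<Longrightarrow> 0 < a n" "mono_on {1..} (\<lambda>n. real n powr (1 / p) / a n)"
    and T: "\<And>l. l \<in> B \<Longrightarrow> n \<le> T l"
  shows "P.prob {x. t * (c * real n powr (1 / p)) < norm (\<Sum>j\<in>{j \<in> J. i j \<in> B}. x j *\<^sub>R u (i j))}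
    \<le> 2 * P.prob {x. t * a n < norm (\<Sum>j\<in>J. truncated_rv a p c T u (x j) (i j))}
      + real (card J) * prob {r. c * real n powr (1 / p) < \<bar>r\<bar>}"
proof -
  let ?b = "c * real n powr (1 / p)"
  \<comment> \<open>This coefficient replaces the length \<open>a (level p c r)\<close> by
    \<open>\<bar>r\<bar>\<close> times the common factor \<open>a n / ?b\<close>. It vanishes off
    \<open>B\<close>, which deletes the other summands.\<close>
  define \<alpha> where "\<alpha> j r = (if i j \<in> B \<and> level p c r \<le> n \<and> r \<noteq> 0 then \<bar>r\<bar> * a n / (?b * a (level p c r)) else 0)"
    for j r
  have [measurable]: "\<alpha> j \<in> borel_measurable borel" for j
    unfolding \<alpha>_def by measurable
  have b: "0 < ?b" using c n by simp
  have \<alpha>_le: "0 \<le> \<alpha> j r \<and> \<alpha> j r \<le> 1" for j r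
  proof (cases "i j \<in> B \<and> level p c r \<le> n \<and> r \<noteq> 0")
    case True
    let ?m = "level p c r"
    have m: "1 \<le> ?m" using level_pos[OF p_pos c] True by blast
    \<comment> \<open>The definition of the level bounds \<open>\<bar>r\<bar>\<close>; monotonicity
      of \<open>real n powr (1 / p) / a n\<close> then compares the level with
      \<open>n\<close>.\<close>
    have "\<bar>r\<bar> * a n \<le> c * real ?m powr (1 / p) * a n"
      using level_le_iff[OF p_pos c, of r ?m] a(1)[OF n] by simp
    also have "\<dots> \<le> ?b * a ?m"
    proof -
      have "real ?m powr (1 / p) / a ?m \<le> real n powr (1 / p) / a n"
        using mono_onD[OF a(2), of ?m n] m n True by auto
      then show ?thesis
        using a(1)[OF m] a(1)[OF n] c by (simp add: field_simps)
    qed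
    finally show ?thesis
      using True b a(1)[OF m] a(1)[OF n] by (simp add: \<alpha>_def)
  qed (auto simp: \<alpha>_def)
  \<comment> \<open>For \<open>i j\<close> in \<open>B\<close> no level up to \<open>n\<close> is
    truncated, since \<open>n \<le> T (i j)\<close>.\<close>
  have \<alpha>_trunc: "\<alpha> j r *\<^sub>R truncated_rv a p c T u r (i j) = (a n / ?b) *\<^sub>R (r *\<^sub>R u (i j))"
    if "i j \<in> B" "level p c r \<le> n" for j r
  proof (cases "r = 0")
    case False
    then have "1 \<le> level p c r" using level_pos[OF p_pos c] by blast
    then show ?thesis
      using that T[OF that(1)] False a(1)[of "level p c r"]
      by (simp add: \<alpha>_def truncated_rv_def abs_mult_sgn mult_ac)
  qed (simp add: truncated_rv_def)
  let ?E1 = "{x. t * ?b < norm (\<Sum>j\<in>{j \<in> J. i j \<in> B}. x j *\<^sub>R u (i j))}"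
  let ?E2 = "{x. t * a n < norm (\<Sum>j\<in>J. \<alpha> j (x j) *\<^sub>R truncated_rv a p c T u (x j) (i j))}"
  let ?F = "\<lambda>j. {x. ?b < \<bar>x j\<bar>}"
  have E2: "?E2 \<in> P.events"
  proof -
    have "{x \<in> space P. t * a n < norm (\<Sum>j\<in>J. \<alpha> j (x j) *\<^sub>R truncated_rv a p c T u (x j) (i j))} \<in> P.events"
      by measurable
    then show ?thesis by simp
  qed
  have F: "?F j \<in> P.events" for j
  proof -
    have "{x \<in> space P. ?b < \<bar>x j\<bar>} \<in> P.events" by measurable
    then show ?thesis by simp
  qed
  have "?E1 \<subseteq> ?E2 \<union> (\<Union>j\<in>J. ?F j)"
  proof
    fix x assume x: "x \<in> ?E1"
    show "x \<in> ?E2 \<union> (\<Union>j\<in>J. ?F j)"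
    proof (cases "\<exists>j\<in>J. ?b < \<bar>x j\<bar>")
      case False
      then have lev: "level p c (x j) \<le> n" if "j \<in> J" for j
        using that by (auto simp: level_le_iff[OF p_pos c])
      have "(\<Sum>j\<in>J. \<alpha> j (x j) *\<^sub>R truncated_rv a p c T u (x j) (i j))
          = (\<Sum>j\<in>{j \<in> J. i j \<in> B}. \<alpha> j (x j) *\<^sub>R truncated_rv a p c T u (x j) (i j))"
        using J by (intro sum.mono_neutral_right) (auto simp: \<alpha>_def)
      also have "\<dots> = (\<Sum>j\<in>{j \<in> J. i j \<in> B}. (a n / ?b) *\<^sub>R (x j *\<^sub>R u (i j)))"
        using lev by (intro sum.cong \<alpha>_trunc) auto
      also have "\<dots> = (a n / ?b) *\<^sub>R (\<Sum>j\<in>{j \<in> J. i j \<in> B}. x j *\<^sub>R u (i j))"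
        by (rule scaleR_sum_right[symmetric])
      finally have "norm (\<Sum>j\<in>J. \<alpha> j (x j) *\<^sub>R truncated_rv a p c T u (x j) (i j))
          = (a n / ?b) * norm (\<Sum>j\<in>{j \<in> J. i j \<in> B}. x j *\<^sub>R u (i j))"
        using b a(1)[OF n] by simp
      moreover have "t * a n = (a n / ?b) * (t * ?b)"
        using c n by simp
      moreover have "(a n / ?b) * (t * ?b) < (a n / ?b) * norm (\<Sum>j\<in>{j \<in> J. i j \<in> B}. x j *\<^sub>R u (i j))"
        using x b a(1)[OF n] by (intro mult_strict_left_mono) auto
      ultimately show ?thesis by simp
    qed auto
  qed
  then have "P.prob ?E1 \<le> P.prob (?E2 \<union> (\<Union>j\<in>J. ?F j))"
    using E2 F J by (intro P.finite_measure_mono sets.Un sets.finite_UN) auto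
  also have "\<dots> \<le> P.prob ?E2 + P.prob (\<Union>j\<in>J. ?F j)"
    using E2 F J by (intro measure_Un_le sets.finite_UN) auto
  also have "P.prob (\<Union>j\<in>J. ?F j) \<le> (\<Sum>j\<in>J. P.prob (?F j))"
    using F J by (intro P.finite_measure_subadditive_finite) auto
  also have "(\<Sum>j\<in>J. P.prob (?F j)) = real (card J) * prob {r. ?b < \<bar>r\<bar>}"
    using measure_coordinate[of "\<lambda>r. ?b < \<bar>r\<bar>"] by simp
  also have "P.prob ?E2 \<le> 2 * P.prob {x. t * a n < norm (\<Sum>j\<in>J. truncated_rv a p c T u (x j) (i j))}"
    using \<alpha>_le J by (intro contraction) (auto simp: truncated_rv_uminus \<alpha>_def)
  finally show ?thesis by simp
qed

text \<open>Grouping equal indices produces the counts to the power 1/p as coefficients. By the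
  count condition they dominate \<open>m powr (1 / p) * norm (w l)\<close>, so contraction, now with
  constant factors, compares the block sum with the grouped sum.\<close>

lemma prob_le_prob_grouped:
  fixes w :: "nat \<Rightarrow> 'b::{banach, second_countable_topology}" and i :: "nat \<Rightarrow> nat"
  assumes J: "finite J" and B: "finite B" "\<And>l. l \<in> B \<Longrightarrow> w l \<noteq> 0" and m: "0 < m"
    and counts: "\<And>l. l \<in> B \<Longrightarrow> m * norm (w l) powr p \<le> real (card {j \<in> J. i j = l})"
  shows "P.prob {x. t < norm (\<Sum>l\<in>B. x l *\<^sub>R w l)}
    \<le> 2 * P.prob {x. t * m powr (1 / p) < norm (\<Sum>j\<in>{j \<in> J. i j \<in> B}. x j *\<^sub>R sgn (w (i j)))}"
proof -
  let ?N = "\<lambda>l. real (card {j \<in> J. i j = l})"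
  have N: "0 < ?N l" if "l \<in> B" for l
  proof -
    have "0 < m * norm (w l) powr p" using m B(2)[OF that] by simp
    then show ?thesis using counts[OF that] by linarith
  qed
  \<comment> \<open>Here \<open>g\<close> is the grouped summand divided by
    \<open>m powr (1 / p)\<close>, and \<open>\<alpha>\<close> shrinks it to
    \<open>r *\<^sub>R w l\<close>.\<close>
  define g where "g l r = (m powr (- 1 / p) * ?N l powr (1 / p) * r) *\<^sub>R sgn (w l)" for l r
  define \<alpha> where "\<alpha> l = norm (w l) * m powr (1 / p) / ?N l powr (1 / p)" for l
  have m1: "m powr (- 1 / p) * m powr (1 / p) = 1"
    using m by (simp add: powr_add[symmetric])
  have [measurable]: "g l \<in> borel_measurable borel" for l
    unfolding g_def by measurable
  have \<alpha>: "0 \<le> \<alpha> l \<and> \<alpha> l \<le> 1" if "l \<in> B" for l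
  proof -
    have "norm (w l) * m powr (1 / p) = (m * norm (w l) powr p) powr (1 / p)"
      using m p_pos by (simp add: powr_mult powr_powr)
    also have "\<dots> \<le> ?N l powr (1 / p)"
      using counts[OF that] m p_pos by (intro powr_mono2) auto
    finally show ?thesis
      using N[OF that] by (simp add: \<alpha>_def)
  qed
  have \<alpha>g: "\<alpha> l *\<^sub>R g l r = r *\<^sub>R w l" if "l \<in> B" for l r
  proof -
    have "\<alpha> l * (m powr (- 1 / p) * ?N l powr (1 / p) * r) = (m powr (- 1 / p) * m powr (1 / p)) * (r * norm (w l))"
      using N[OF that] by (simp add: \<alpha>_def)
    also have "\<dots> = r * norm (w l)" by (simp only: m1)
    finally have "\<alpha> l *\<^sub>R g l r = (r * norm (w l)) *\<^sub>R sgn (w l)"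
      by (simp add: g_def)
    then show ?thesis
      using B(2)[OF that] by (simp add: sgn_div_norm)
  qed
  have "P.prob {x. t < norm (\<Sum>l\<in>B. x l *\<^sub>R w l)} = P.prob {x. t < norm (\<Sum>l\<in>B. \<alpha> l *\<^sub>R g l (x l))}"
    using \<alpha>g by simp
  also have "\<dots> \<le> 2 * P.prob {x. t < norm (\<Sum>l\<in>B. g l (x l))}"
    using \<alpha> B(1) by (intro contraction) (auto simp: g_def)
  also have "P.prob {x. t < norm (\<Sum>l\<in>B. g l (x l))}
      = P.prob {x. t * m powr (1 / p) < norm (\<Sum>l\<in>B. (?N l powr (1 / p) * x l) *\<^sub>R sgn (w l))}"
  proof -
    have "norm (\<Sum>l\<in>B. g l (x l)) = m powr (- 1 / p) * norm (\<Sum>l\<in>B. (?N l powr (1 / p) * x l) *\<^sub>R sgn (w l))" for x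
    proof -
      have "(\<Sum>l\<in>B. g l (x l)) = m powr (- 1 / p) *\<^sub>R (\<Sum>l\<in>B. (?N l powr (1 / p) * x l) *\<^sub>R sgn (w l))"
        by (simp add: scaleR_sum_right g_def mult.assoc)
      then show ?thesis by simp
    qed
    then have "t < norm (\<Sum>l\<in>B. g l (x l)) \<longleftrightarrow>
        t * m powr (1 / p) < norm (\<Sum>l\<in>B. (?N l powr (1 / p) * x l) *\<^sub>R sgn (w l))" for x
      using m by (simp add: powr_minus_divide pos_less_divide_eq)
    then show ?thesis by simp
  qed
  also have "\<dots> = P.prob {x. t * m powr (1 / p) < norm (\<Sum>j\<in>{j \<in> J. i j \<in> B}. x j *\<^sub>R sgn (w (i j)))}"
  proof (rule prob_grouped_sum[OF J B(1), symmetric])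
    fix l assume "l \<in> B"
    then show "{j \<in> J. i j = l} \<noteq> {}"
      using N[of l] by force
  qed
  finally show ?thesis .
qed

end

section \<open>Independent pairs of sequences\<close>

text \<open>Fubini restricted to \<open>G\<close>: an estimate proved for each fixed index sequence
  passes to the joint law.\<close>

lemma (in pair_prob_space) prob_pair_ge:
  assumes E: "E \<in> sets (M1 \<Otimes>\<^sub>M M2)" and G: "G \<in> sets M2" and "0 \<le> b"
    and ge: "\<And>y. y \<in> G \<Longrightarrow> b \<le> measure M1 ((\<lambda>x. (x, y)) -` E)"
  shows "b * measure M2 G \<le> measure (M1 \<Otimes>\<^sub>M M2) E"
proof -
  have "ennreal (b * measure M2 G) = (\<integral>\<^sup>+y. ennreal b * indicator G y \<partial>M2)"
    using G \<open>0 \<le> b\<close> by (simp add: nn_integral_cmult M2.emeasure_eq_measure ennreal_mult)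
  also have "\<dots> \<le> (\<integral>\<^sup>+y. emeasure M1 ((\<lambda>x. (x, y)) -` E) \<partial>M2)"
    using ge by (intro nn_integral_mono) (auto simp: indicator_def M1.emeasure_eq_measure ennreal_leI)
  also have "\<dots> = emeasure (M1 \<Otimes>\<^sub>M M2) E"
    by (rule emeasure_pair_measure_alt2[OF E, symmetric])
  finally show ?thesis
    by (simp add: P.emeasure_eq_measure)
qed

locale two_laws = L1: law_sequence \<mu> + L2: law_sequence \<nu> for \<mu> \<nu> :: "real measure"
begin

text \<open>Coordinates \<open>(j, True)\<close> have law \<open>\<mu>\<close> and coordinates \<open>(j, False)\<close> have law \<open>\<nu>\<close>.\<close>

definition \<Omega> :: "(nat \<times> bool \<Rightarrow> real) measure" where
  "\<Omega> = (\<Pi>\<^sub>M k\<in>UNIV. if snd k then \<mu> else \<nu>)"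

text \<open>On \<open>\<Omega>\<close> independence in \<open>j\<close> follows by grouping
  coordinates, whereas Fubini needs the two halves as a pair of sequences; this map connects the two
  views.\<close>

definition split_seq :: "(nat \<times> bool \<Rightarrow> real) \<Rightarrow> (nat \<Rightarrow> real) \<times> (nat \<Rightarrow> real)" where
  "split_seq \<omega> = (\<lambda>j. \<omega> (j, True), \<lambda>j. \<omega> (j, False))"

lemma prob_space_factor: "prob_space (if b then \<mu> else \<nu>)"
  using L1.prob_space_axioms L2.prob_space_axioms by simp

sublocale \<Omega>: prob_space \<Omega>
  unfolding \<Omega>_def by (intro prob_space_PiM prob_space_factor)

sublocale LP: pair_prob_space L1.P L2.P
  by unfold_locales

lemma sets_\<Omega> [measurable_cong]: "sets \<Omega> = sets (\<Pi>\<^sub>M k\<in>UNIV. borel)"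
  unfolding \<Omega>_def by (intro sets_PiM_cong) auto

lemma space_\<Omega> [simp]: "space \<Omega> = UNIV"
  using sets_eq_imp_space_eq[OF sets_\<Omega>] by (simp add: space_PiM)

lemma coordinate_\<Omega> [measurable]: "(\<lambda>\<omega>. \<omega> k) \<in> borel_measurable \<Omega>"
  by (subst measurable_cong_sets[OF sets_\<Omega> refl]) (rule measurable_component_singleton, simp)

lemma pair_coordinate_\<Omega>: "(\<lambda>\<omega>. (\<omega> (j, True), \<omega> (j, False))) \<in> \<Omega> \<rightarrow>\<^sub>M borel \<Otimes>\<^sub>M borel"
  by (intro measurable_Pair coordinate_\<Omega>)

lemma indep_vars_\<Omega>: "\<Omega>.indep_vars (\<lambda>_. borel) (\<lambda>k \<omega>. \<omega> k) UNIV"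
  unfolding \<Omega>_def by (intro indep_vars_PiM_coordinates prob_space_factor) auto

lemma split_seq_measurable: "split_seq \<in> \<Omega> \<rightarrow>\<^sub>M L1.P \<Otimes>\<^sub>M L2.P"
proof -
  have "split_seq \<in> \<Omega> \<rightarrow>\<^sub>M (\<Pi>\<^sub>M _\<in>UNIV. borel) \<Otimes>\<^sub>M (\<Pi>\<^sub>M _\<in>UNIV. borel)"
    unfolding split_seq_def by (intro measurable_Pair measurable_PiM_single' coordinate_\<Omega>) auto
  then show ?thesis
    by (simp cong: measurable_cong_sets sets_pair_measure_cong)
qed

lemma distr_block:
  "distr \<Omega> (\<Pi>\<^sub>M _\<in>UNIV. borel) (\<lambda>\<omega> j. \<omega> (j :: nat, b)) = (\<Pi>\<^sub>M _\<in>UNIV. if b then \<mu> else \<nu>)"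
proof -
  have "distr \<Omega> (\<Pi>\<^sub>M j\<in>UNIV. if snd (j :: nat, b) then \<mu> else \<nu>) (\<lambda>\<omega>. \<lambda>j\<in>UNIV. \<omega> (j, b))
      = (\<Pi>\<^sub>M j\<in>UNIV. if snd (j :: nat, b) then \<mu> else \<nu>)"
    unfolding \<Omega>_def
    by (rule distr_PiM_reindex[where f = "\<lambda>j. (j, b)" and K = UNIV]) (auto simp: inj_on_def prob_space_factor)
  moreover have "distr \<Omega> (\<Pi>\<^sub>M j\<in>UNIV. if snd (j :: nat, b) then \<mu> else \<nu>) (\<lambda>\<omega>. \<lambda>j\<in>UNIV. \<omega> (j, b))
      = distr \<Omega> (\<Pi>\<^sub>M _\<in>UNIV. borel) (\<lambda>\<omega> j. \<omega> (j, b))"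
    by (intro distr_cong sets_PiM_cong) auto
  ultimately show ?thesis by simp
qed

text \<open>The two halves use disjoint sets of coordinates and are therefore independent, and each
  half has a product law.\<close>

lemma distr_split_seq: "distr \<Omega> (L1.P \<Otimes>\<^sub>M L2.P) split_seq = L1.P \<Otimes>\<^sub>M L2.P"
proof -
  let ?A = "\<lambda>b. {k :: nat \<times> bool. snd k = b}"
  let ?f = "\<lambda>b (z :: nat \<times> bool \<Rightarrow> real) (j :: nat). z (j, b)"
  have f: "?f b \<in> PiM (?A b) (\<lambda>_. borel) \<rightarrow>\<^sub>M (\<Pi>\<^sub>M _\<in>UNIV. borel)" for b
    by (intro measurable_PiM_single') auto
  have "\<Omega>.indep_var (PiM (?A True) (\<lambda>_. borel)) (\<lambda>\<omega>. restrict (\<lambda>k. \<omega> k) (?A True))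
      (PiM (?A False) (\<lambda>_. borel)) (\<lambda>\<omega>. restrict (\<lambda>k. \<omega> k) (?A False))"
    by (rule \<Omega>.indep_var_restrict[OF indep_vars_\<Omega>]) auto
  from \<Omega>.indep_var_compose[OF this f f]
  have "\<Omega>.indep_var (\<Pi>\<^sub>M _\<in>UNIV. borel) (\<lambda>\<omega> j. \<omega> (j, True)) (\<Pi>\<^sub>M _\<in>UNIV. borel) (\<lambda>\<omega> j. \<omega> (j, False))"
    by (simp add: comp_def)
  then have "distr \<Omega> (\<Pi>\<^sub>M _\<in>UNIV. borel) (\<lambda>\<omega> j. \<omega> (j, True)) \<Otimes>\<^sub>M distr \<Omega> (\<Pi>\<^sub>M _\<in>UNIV. borel) (\<lambda>\<omega> j. \<omega> (j, False))
      = distr \<Omega> ((\<Pi>\<^sub>M _\<in>UNIV. borel) \<Otimes>\<^sub>M (\<Pi>\<^sub>M _\<in>UNIV. borel)) (\<lambda>\<omega>. (\<lambda>j. \<omega> (j, True), \<lambda>j. \<omega> (j, False)))"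
    unfolding \<Omega>.indep_var_distribution_eq by blast
  also have "\<dots> = distr \<Omega> (L1.P \<Otimes>\<^sub>M L2.P) split_seq"
    by (intro distr_cong sets_pair_measure_cong) (auto simp: split_seq_def)
  finally show ?thesis
    by (simp add: distr_block)
qed

lemma distr_pair_coordinate:
  "distr \<Omega> (borel \<Otimes>\<^sub>M borel) (\<lambda>\<omega>. (\<omega> (j, True), \<omega> (j, False))) = \<mu> \<Otimes>\<^sub>M \<nu>"
proof -
  let ?g = "\<lambda>(x, y). (x j, y j) :: real \<times> real"
  have g: "?g \<in> L1.P \<Otimes>\<^sub>M L2.P \<rightarrow>\<^sub>M borel \<Otimes>\<^sub>M borel"
    by measurable
  have "\<mu> \<Otimes>\<^sub>M \<nu> = distr L1.P borel (\<lambda>x. x j) \<Otimes>\<^sub>M distr L2.P borel (\<lambda>x. x j)"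
    by (simp add: L1.distr_coordinate L2.distr_coordinate)
  also have "\<dots> = distr (L1.P \<Otimes>\<^sub>M L2.P) (borel \<Otimes>\<^sub>M borel) ?g"
    by (intro pair_measure_distr) (auto simp: L2.distr_coordinate L2.sigma_finite_measure_axioms)
  also have "\<dots> = distr (distr \<Omega> (L1.P \<Otimes>\<^sub>M L2.P) split_seq) (borel \<Otimes>\<^sub>M borel) ?g"
    by (simp only: distr_split_seq)
  also have "\<dots> = distr \<Omega> (borel \<Otimes>\<^sub>M borel) (\<lambda>\<omega>. (\<omega> (j, True), \<omega> (j, False)))"
    by (subst distr_distr[OF g split_seq_measurable]) (simp add: comp_def split_seq_def)
  finally show ?thesis by simp
qed

lemma distr_fun_coordinate:
  assumes f: "case_prod f \<in> borel \<Otimes>\<^sub>M borel \<rightarrow>\<^sub>M borel"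
  shows "distr \<Omega> borel (\<lambda>\<omega>. f (\<omega> (j, True)) (\<omega> (j, False))) = distr (\<mu> \<Otimes>\<^sub>M \<nu>) borel (case_prod f)"
proof -
  show ?thesis
    unfolding distr_pair_coordinate[of j, symmetric]
    by (subst distr_distr[OF f pair_coordinate_\<Omega>]) (simp add: comp_def)
qed

lemma iid_copies_fun:
  fixes f :: "real \<Rightarrow> real \<Rightarrow> 'b::topological_space"
  assumes f: "case_prod f \<in> borel \<Otimes>\<^sub>M borel \<rightarrow>\<^sub>M borel"
  shows "iid_copies \<Omega> (\<lambda>\<omega>. f (\<omega> (0, True)) (\<omega> (0, False))) (\<lambda>j \<omega>. f (\<omega> (j, True)) (\<omega> (j, False)))"
  unfolding iid_copies_def
proof (intro conjI allI impI)
  show "prob_space \<Omega>" by (rule \<Omega>.prob_space_axioms)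
  show "(\<lambda>\<omega>. f (\<omega> (0, True)) (\<omega> (0, False))) \<in> borel_measurable \<Omega>"
    using measurable_compose[OF pair_coordinate_\<Omega> f] by simp
  let ?K = "\<lambda>j. {(j, True), (j, False)}"
  have "\<Omega>.indep_vars (\<lambda>j. PiM (?K j) (\<lambda>_. borel)) (\<lambda>j \<omega>. restrict (\<lambda>k. \<omega> k) (?K j)) {1..}"
    by (rule \<Omega>.indep_vars_restrict[OF indep_vars_\<Omega>]) (auto simp: disjoint_family_on_def)
  then have "\<Omega>.indep_vars (\<lambda>_. borel) (\<lambda>j \<omega>. case_prod f
      (restrict (\<lambda>k. \<omega> k) (?K j) (j, True), restrict (\<lambda>k. \<omega> k) (?K j) (j, False))) {1..}"
  proof (rule \<Omega>.indep_vars_compose2)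
    fix j :: nat
    have "(\<lambda>z. (z (j, True), z (j, False))) \<in> PiM (?K j) (\<lambda>_. borel) \<rightarrow>\<^sub>M borel \<Otimes>\<^sub>M borel"
      by (intro measurable_Pair measurable_component_singleton) auto
    from measurable_compose[OF this f]
    show "(\<lambda>z. case_prod f (z (j, True), z (j, False))) \<in> PiM (?K j) (\<lambda>_. borel) \<rightarrow>\<^sub>M borel" .
  qed
  then show "\<Omega>.indep_vars (\<lambda>_. borel) (\<lambda>j \<omega>. f (\<omega> (j, True)) (\<omega> (j, False))) {1..}"
    by simp
  show "distr \<Omega> borel (\<lambda>\<omega>. f (\<omega> (j, True)) (\<omega> (j, False))) = distr \<Omega> borel (\<lambda>\<omega>. f (\<omega> (0, True)) (\<omega> (0, False)))" for j
    by (simp only: distr_fun_coordinate[OF f])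
qed

text \<open>The sign sits in the first coordinate: the map from \<open>(x, y)\<close> to
  \<open>(- x, y)\<close> preserves the product law, and \<open>f\<close> turns it into
  negation.\<close>

lemma symmetric_rv_fun:
  fixes f :: "real \<Rightarrow> real \<Rightarrow> 'b::{banach, second_countable_topology}"
  assumes f: "case_prod f \<in> borel \<Otimes>\<^sub>M borel \<rightarrow>\<^sub>M borel"
    and odd: "\<And>x y. f (- x) y = - f x y" and sym: "distr \<mu> borel uminus = \<mu>"
  shows "symmetric_rv \<Omega> (\<lambda>\<omega>. f (\<omega> (0, True)) (\<omega> (0, False)))"
proof -
  have f': "case_prod (\<lambda>x y. - f x y) \<in> borel \<Otimes>\<^sub>M borel \<rightarrow>\<^sub>M borel"
    using f by (simp add: split_beta')
  have \<nu>: "distr \<nu> borel (\<lambda>y. y) = \<nu>"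
    by (rule distr_id2) simp
  have "\<mu> \<Otimes>\<^sub>M \<nu> = distr \<mu> borel uminus \<Otimes>\<^sub>M distr \<nu> borel (\<lambda>y. y)"
    by (simp only: sym \<nu>)
  also have "\<dots> = distr (\<mu> \<Otimes>\<^sub>M \<nu>) (borel \<Otimes>\<^sub>M borel) (\<lambda>(x, y). (- x, y))"
    by (intro pair_measure_distr) (auto simp: \<nu> L2.sigma_finite_measure_axioms)
  finally have eq: "\<mu> \<Otimes>\<^sub>M \<nu> = distr (\<mu> \<Otimes>\<^sub>M \<nu>) (borel \<Otimes>\<^sub>M borel) (\<lambda>(x, y). (- x, y))" .
  have neg: "(\<lambda>(x, y). (- x, y)) \<in> \<mu> \<Otimes>\<^sub>M \<nu> \<rightarrow>\<^sub>M borel \<Otimes>\<^sub>M borel"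
    by measurable
  have "distr (\<mu> \<Otimes>\<^sub>M \<nu>) borel (case_prod f) = distr (distr (\<mu> \<Otimes>\<^sub>M \<nu>) (borel \<Otimes>\<^sub>M borel) (\<lambda>(x, y). (- x, y))) borel (case_prod f)"
    by (simp only: eq[symmetric])
  also have "\<dots> = distr (\<mu> \<Otimes>\<^sub>M \<nu>) borel (case_prod (\<lambda>x y. - f x y))"
    by (subst distr_distr[OF f neg]) (simp add: comp_def split_beta' odd)
  finally show ?thesis
    unfolding symmetric_rv_def
    using distr_fun_coordinate[OF f, of 0] distr_fun_coordinate[OF f', of 0] by simp
qed

lemma prob_split_seq:
  assumes [measurable]: "Measurable.pred (L1.P \<Otimes>\<^sub>M L2.P) Q"
  shows "\<Omega>.prob {\<omega>. Q (split_seq \<omega>)} = measure (L1.P \<Otimes>\<^sub>M L2.P) {z \<in> space (L1.P \<Otimes>\<^sub>M L2.P). Q z}"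
  (is "_ = measure _ ?E")
proof -
  have E: "?E \<in> sets (L1.P \<Otimes>\<^sub>M L2.P)"
    by measurable
  have "measure (L1.P \<Otimes>\<^sub>M L2.P) ?E = measure (distr \<Omega> (L1.P \<Otimes>\<^sub>M L2.P) split_seq) ?E"
    by (simp only: distr_split_seq)
  also have "\<dots> = \<Omega>.prob {\<omega>. Q (split_seq \<omega>)}"
    by (subst measure_distr[OF split_seq_measurable E])
       (auto simp: space_pair_measure intro!: arg_cong[where f = \<Omega>.prob])
  finally show ?thesis by simp
qed

lemma prob_coordinates:
  assumes A: "A \<in> sets borel" and B: "B \<in> sets borel"
  shows "\<Omega>.prob {\<omega>. \<omega> (j, True) \<in> A \<and> \<omega> (j, False) \<in> B} = L1.prob A * L2.prob B"
proof -
  have "L1.prob A * L2.prob B = measure (\<mu> \<Otimes>\<^sub>M \<nu>) (A \<times> B)"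
    using A B by (simp add: measure_def L2.emeasure_pair_measure_Times enn2real_mult)
  also have "\<dots> = measure (distr \<Omega> (borel \<Otimes>\<^sub>M borel) (\<lambda>\<omega>. (\<omega> (j, True), \<omega> (j, False)))) (A \<times> B)"
    by (simp only: distr_pair_coordinate)
  also have "\<dots> = \<Omega>.prob ((\<lambda>\<omega>. (\<omega> (j, True), \<omega> (j, False))) -` (A \<times> B) \<inter> space \<Omega>)"
    using A B by (intro measure_distr pair_coordinate_\<Omega>) auto
  also have "(\<lambda>\<omega>. (\<omega> (j, True), \<omega> (j, False))) -` (A \<times> B) \<inter> space \<Omega> = {\<omega>. \<omega> (j, True) \<in> A \<and> \<omega> (j, False) \<in> B}"
    by auto
  finally show ?thesis by simp
qed

end

section \<open>The counterexample\<close>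

text \<open>The random index is stored in a real coordinate and decoded by
  \<open>nat \<lfloor>r\<rfloor>\<close>, so that index and stable value both fit into
  \<open>two_laws\<close>.\<close>

lemma exists_law_on_nat:
  fixes g :: "nat \<Rightarrow> real"
  assumes "\<And>l. 0 \<le> g l" "g sums 1"
  obtains \<nu> where "real_distribution \<nu>" "\<And>l. measure \<nu> {r. nat \<lfloor>r\<rfloor> = l} = g l"
proof
  have "(\<integral>\<^sup>+ l. ennreal (g l) \<partial>count_space UNIV) = 1"
    using assms by (simp add: nn_integral_count_space_nat suminf_ennreal2 sums_iff)
  then have pmf: "pmf (embed_pmf g) l = g l" for l
    using assms(1) by (intro pmf_embed_pmf) auto
  let ?\<nu> = "distr (measure_pmf (embed_pmf g)) borel real"
  show "real_distribution ?\<nu>"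
    by (intro prob_space.real_distribution_distr[OF prob_space_measure_pmf]) auto
  show "measure ?\<nu> {r. nat \<lfloor>r\<rfloor> = l} = g l" for l
  proof -
    have "measure ?\<nu> {r. nat \<lfloor>r\<rfloor> = l} = measure (measure_pmf (embed_pmf g)) {l}"
      by (subst measure_distr) (auto simp: vimage_def)
    then show ?thesis
      by (simp add: measure_pmf_single pmf)
  qed
qed

section \<open>Divergence of a stable series against the weak law\<close>

context stable_law
begin

lemma AE_summable_of_wlln:
  fixes w :: "nat \<Rightarrow> 'b::{banach, second_countable_topology}"
  assumes a: "\<And>n. n \<ge> 1 \<Longrightarrow> 0 < a n" "strict_mono_on {1..} a"
      "mono_on {1..} (\<lambda>n. real n powr (1 / p) / a n)"
    and wlln: "\<And>(M :: (nat \<Rightarrow> 'b) measure) (X :: (nat \<Rightarrow> 'b) \<Rightarrow> 'b) Xs.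
         iid_copies M X Xs \<Longrightarrow> symmetric_rv M X \<Longrightarrow>
         tendsto_in_prob M (\<lambda>n \<omega>. (\<Sum>i=1..n. Xs i \<omega>) /\<^sub>R a n) (\<lambda>_. 0) \<longleftrightarrow>
         (\<lambda>n. real n * measure M {\<omega> \<in> space M. norm (X \<omega>) > a n}) \<longlonglongrightarrow> 0"
    and w: "summable (\<lambda>l. norm (w l) powr p)"
  shows "AE x in P. summable (\<lambda>l. x l *\<^sub>R w l)"
proof (rule ccontr)
  assume not_AE: "\<not> ?thesis"
  define V where "V = (\<Sum>l. norm (w l) powr p)"
  have "V \<noteq> 0"
  proof
    assume "V = 0"
    then have "\<forall>l. w l = 0"
      using suminf_eq_zero_iff[OF w] by (simp add: V_def)
    then show False using not_AE by simp
  qed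
  then have V: "0 < V"
    using suminf_nonneg[OF w] by (simp add: V_def)
  have "(\<lambda>l. norm (w l) powr p / V) sums (V / V)"
    using w unfolding V_def by (intro sums_divide summable_sums)
  then obtain \<nu> where "real_distribution \<nu>"
    and \<nu>: "\<And>l. measure \<nu> {r. nat \<lfloor>r\<rfloor> = l} = norm (w l) powr p / V"
    using exists_law_on_nat[of "\<lambda>l. norm (w l) powr p / V"] V by auto
  then interpret L2: real_distribution \<nu> by simp
  interpret two_laws \<mu> \<nu> ..
  define h where "h = (\<lambda>r :: real. nat \<lfloor>r\<rfloor>)"
  have h [measurable]: "h \<in> borel \<rightarrow>\<^sub>M count_space UNIV"
    unfolding h_def by measurable

  \<comment> \<open>The Cauchy criterion uses one number as threshold and as probability, so its
    failure supplies a single \<open>\<epsilon>\<close> for both.\<close>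
  have "\<exists>\<epsilon>>0. \<forall>m. \<exists>n\<ge>m. \<epsilon> < P.prob {x. \<epsilon> < norm (\<Sum>l\<in>{m..<n}. x l *\<^sub>R w l)}"
    using not_AE
  proof (rule contrapos_np)
    assume neg: "\<not> ?thesis"
    have "\<exists>m. \<forall>n\<ge>m. P.prob {x. e < norm (\<Sum>l\<in>{m..<n}. x l *\<^sub>R w l)} \<le> e" if "0 < e" for e
    proof (rule ccontr)
      assume "\<not> ?thesis"
      then have "\<forall>m. \<exists>n\<ge>m. e < P.prob {x. e < norm (\<Sum>l\<in>{m..<n}. x l *\<^sub>R w l)}"
        by (simp add: not_le)
      then show False using neg that by blast
    qed
    then show "AE x in P. summable (\<lambda>l. x l *\<^sub>R w l)"
      by (rule AE_summable_of_Cauchy_in_prob)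
  qed
  then obtain \<epsilon> where \<epsilon>: "0 < \<epsilon>"
    and ex: "\<forall>m. \<exists>n. m \<le> n \<and> \<epsilon> < P.prob {x. \<epsilon> < norm (\<Sum>l\<in>{m..<n}. x l *\<^sub>R w l)}"
    by blast
  obtain N where N: "\<forall>m. m \<le> N m \<and> \<epsilon> < P.prob {x. \<epsilon> < norm (\<Sum>l\<in>{m..<N m}. x l *\<^sub>R w l)}"
    using choice[OF ex] by (elim exE)
  \<comment> \<open>Indices with \<open>w l = 0\<close> are dropped so that every index of a block
    is drawn with positive probability.\<close>
  define B where "B k = {l \<in> {k..<N k}. w l \<noteq> 0}" for k
  have B: "finite (B k)" "\<And>l. l \<in> B k \<Longrightarrow> w l \<noteq> 0" "\<And>l. l \<in> B k \<Longrightarrow> k \<le> l" for k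
    by (auto simp: B_def)
  have large: "\<epsilon> < P.prob {x. \<epsilon> < norm (\<Sum>l\<in>B k. x l *\<^sub>R w l)}" for k
  proof -
    have "(\<Sum>l\<in>B k. x l *\<^sub>R w l) = (\<Sum>l\<in>{k..<N k}. x l *\<^sub>R w l)" for x :: "nat \<Rightarrow> real"
      by (intro sum.mono_neutral_left) (auto simp: B_def)
    then show ?thesis using N by simp
  qed
  \<comment> \<open>The grouping estimate doubles \<open>\<epsilon> / 4\<close>, which leaves half
    of \<open>\<epsilon>\<close> for the truncated sums.\<close>
  obtain c where c: "0 < c" and tail_c: "\<And>n. n \<ge> 1 \<Longrightarrow> real n * prob {r. c * real n powr (1 / p) < \<bar>r\<bar>} \<le> \<epsilon> / 4"
    using tail_bound[of "\<epsilon> / 4"] \<epsilon> by auto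

  let ?G = "\<lambda>k n. {y. \<forall>l\<in>B k. real n * L2.prob {r. h r = l} / 2 \<le> real (card {j \<in> {1..n}. h (y j) = l})}"
  \<comment> \<open>The condition \<open>Suc k \<le> n\<close> gives positive sample sizes that
    exceed any threshold as \<open>k\<close> grows.\<close>
  have "\<exists>n\<ge>Suc k. 1 / 2 \<le> L2.P.prob (?G k n)" for k
    using B V by (intro L2.large_counts) (auto simp: h_def \<nu>)
  then have "\<forall>k. \<exists>n. Suc k \<le> n \<and> 1 / 2 \<le> L2.P.prob (?G k n)"
    by simp
  from choice[OF this] obtain n where "\<forall>k. Suc k \<le> n k \<and> 1 / 2 \<le> L2.P.prob (?G k (n k))"
    by (elim exE)
  then have n: "Suc k \<le> n k" "1 / 2 \<le> L2.P.prob (?G k (n k))" for k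
    by simp_all
  \<comment> \<open>Block \<open>B k\<close> only contains indices \<open>l \<ge> k\<close>, so a
    maximum over finitely many sample sizes makes one truncation level serve all blocks.\<close>
  define T where "T l = Max (n ` {..l})" for l
  have T: "n k \<le> T l" if "l \<in> B k" for k l
    using B(3)[OF that] by (auto simp: T_def)

  define f where "f r y = truncated_rv a p c T (\<lambda>l. sgn (w l)) r (h y)" for r y
  have f: "case_prod f \<in> borel \<Otimes>\<^sub>M borel \<rightarrow>\<^sub>M borel"
  proof -
    have "(\<lambda>z. truncated_rv a p c T (\<lambda>l. sgn (w l)) (fst z) (h (snd z))) \<in> borel \<Otimes>\<^sub>M borel \<rightarrow>\<^sub>M borel"
      by (rule measurable_compose_countable) measurable
    then show ?thesis by (simp add: f_def split_beta')
  qed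
  have f_meas [measurable]: "(\<lambda>z. f (g z) (g' z)) \<in> borel_measurable M"
    if "g \<in> borel_measurable M" "g' \<in> borel_measurable M" for g g' and M :: "'x measure"
    using measurable_compose[OF measurable_Pair[OF that] f] by simp
  let ?X = "\<lambda>j \<omega>. f (\<omega> (j :: nat, True)) (\<omega> (j, False))"
  have C: "{y. n < T (h y)} \<in> sets borel" for n
    using measurable_sets[OF h, of "{l. n < T l}"] by (simp add: vimage_def)
  have "(\<lambda>n. real n * \<Omega>.prob {\<omega> \<in> space \<Omega>. norm (?X 0 \<omega>) > a n}) \<longlonglongrightarrow> 0"
  \<comment> \<open>The tail splits into a stable factor, bounded by \<open>\<epsilon> / 4\<close>
    after multiplication by \<open>n\<close>, and the probability that \<open>T\<close> of the index
    exceeds \<open>n\<close>, which vanishes because \<open>T\<close> is finite everywhere.\<close>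
  proof (rule tendsto_sandwich[where f = "\<lambda>_. 0"])
    have "(\<lambda>n. L2.prob {y. n < T (h y)}) \<longlonglongrightarrow> L2.prob (\<Inter>n. {y. n < T (h y)})"
    proof (rule L2.finite_Lim_measure_decseq)
      show "range (\<lambda>n. {y. n < T (h y)}) \<subseteq> L2.events" using C by auto
    qed (auto simp: decseq_def)
    moreover have "(\<Inter>n. {y. n < T (h y)}) = {}" by blast
    ultimately show "(\<lambda>n. \<epsilon> / 4 * L2.prob {y. n < T (h y)}) \<longlonglongrightarrow> 0"
      by (auto intro!: tendsto_mult_right_zero)
    show "eventually (\<lambda>n. real n * \<Omega>.prob {\<omega> \<in> space \<Omega>. norm (?X 0 \<omega>) > a n} \<le> \<epsilon> / 4 * L2.prob {y. n < T (h y)}) sequentially"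
      using eventually_ge_at_top[of 1]
    proof eventually_elim
      case (elim m)
      let ?A = "{r. c * real m powr (1 / p) < \<bar>r\<bar>}" and ?C = "{y. m < T (h y)}"
      have A: "?A \<in> sets borel" by measurable
      have "\<Omega>.prob {\<omega> \<in> space \<Omega>. norm (?X 0 \<omega>) > a m} \<le> \<Omega>.prob {\<omega>. \<omega> (0, True) \<in> ?A \<and> \<omega> (0, False) \<in> ?C}"
      proof (rule \<Omega>.finite_measure_mono)
        have "{\<omega> \<in> space \<Omega>. \<omega> (0, True) \<in> ?A \<and> \<omega> (0, False) \<in> ?C} \<in> \<Omega>.events"
          using A C by measurable
        then show "{\<omega>. \<omega> (0, True) \<in> ?A \<and> \<omega> (0, False) \<in> ?C} \<in> \<Omega>.events" by simp
        show "{\<omega> \<in> space \<Omega>. norm (?X 0 \<omega>) > a m} \<subseteq> {\<omega>. \<omega> (0, True) \<in> ?A \<and> \<omega> (0, False) \<in> ?C}"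
          using norm_truncated_rv_gt[OF p_pos c elim a(2) a(1), of "\<lambda>l. sgn (w l)"]
          by (force simp: f_def norm_sgn)
      qed
      also have "\<dots> = prob ?A * L2.prob ?C"
        by (rule prob_coordinates[OF A C])
      finally have "real m * \<Omega>.prob {\<omega> \<in> space \<Omega>. norm (?X 0 \<omega>) > a m} \<le> (real m * prob ?A) * L2.prob ?C"
        by (simp add: mult.assoc mult_left_mono)
      also have "\<dots> \<le> \<epsilon> / 4 * L2.prob ?C"
        by (intro mult_right_mono tail_c elim) auto
      finally show ?case .
    qed
  qed auto
  then have "tendsto_in_prob \<Omega> (\<lambda>n \<omega>. (\<Sum>i=1..n. ?X i \<omega>) /\<^sub>R a n) (\<lambda>_. 0)"
    using wlln_any_space[OF wlln iid_copies_fun[OF f] symmetric_rv_fun[OF f _ distr_uminus]]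
    by (simp add: f_def truncated_rv_uminus)
  \<comment> \<open>This choice makes \<open>\<epsilon> * (real m / (2 * V)) powr (1 / p)\<close>
    equal to \<open>\<delta> * (c * real m powr (1 / p))\<close>, matching the thresholds of the
    grouping and truncation estimates.\<close>
  moreover define \<delta> where "\<delta> = \<epsilon> / (c * (2 * V) powr (1 / p))"
  have "0 < \<delta>"
    using \<epsilon> c V by (simp add: \<delta>_def)
  ultimately have "(\<lambda>n. \<Omega>.prob {\<omega> \<in> space \<Omega>. \<delta> < dist ((\<Sum>i=1..n. ?X i \<omega>) /\<^sub>R a n) 0}) \<longlonglongrightarrow> 0"
    by (auto simp: tendsto_in_prob_def)
  \<comment> \<open>The bound to be contradicted is \<open>\<epsilon> / 8\<close>, valid for each
    favourable index sequence, times the probability 1/2 of such sequences.\<close>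
  then have "eventually (\<lambda>n. \<Omega>.prob {\<omega> \<in> space \<Omega>. \<delta> < dist ((\<Sum>i=1..n. ?X i \<omega>) /\<^sub>R a n) 0} < \<epsilon> / 16) sequentially"
    using \<epsilon> by (intro order_tendstoD) auto
  then obtain k where k: "\<And>n. n \<ge> k \<Longrightarrow> \<Omega>.prob {\<omega> \<in> space \<Omega>. \<delta> < dist ((\<Sum>i=1..n. ?X i \<omega>) /\<^sub>R a n) 0} < \<epsilon> / 16"
    by (auto simp: eventually_at_top_linorder)

  define m where "m = n k"
  have m: "1 \<le> m" "k \<le> m" "1 / 2 \<le> L2.P.prob (?G k m)"
    using n[of k] by (auto simp: m_def)
  let ?Q = "\<lambda>z. \<delta> * a m < norm (\<Sum>j\<in>{1..m}. f (fst z j) (snd z j))"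
  let ?E = "{z \<in> space (P \<Otimes>\<^sub>M L2.P). ?Q z}"
  have Q: "Measurable.pred (P \<Otimes>\<^sub>M L2.P) ?Q"
    by measurable
  have "\<epsilon> / 8 * L2.P.prob (?G k m) \<le> measure (P \<Otimes>\<^sub>M L2.P) ?E"
  proof (rule LP.prob_pair_ge)
    show "?E \<in> sets (P \<Otimes>\<^sub>M L2.P)" using Q by measurable
    have "{y \<in> space L2.P. \<forall>l\<in>B k. real m * L2.prob {r. h r = l} / 2 \<le> real (card {j \<in> {1..m}. h (y j) = l})} \<in> sets L2.P"
      using B(1)[of k] by measurable
    then show "?G k m \<in> sets L2.P" by simp
    fix y assume y: "y \<in> ?G k m"
    let ?p = "P.prob {x. \<delta> * a m < norm (\<Sum>j\<in>{1..m}. f (x j) (y j))}"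
    \<comment> \<open>As \<open>l\<close> is drawn with probability
      \<open>norm (w l) powr p / V\<close>, favourable counts are at least
      \<open>real m / (2 * V) * norm (w l) powr p\<close>.\<close>
    have "P.prob {x. \<epsilon> < norm (\<Sum>l\<in>B k. x l *\<^sub>R w l)} \<le> 2 * P.prob {x. \<epsilon> * (real m / (2 * V)) powr (1 / p)
        < norm (\<Sum>j\<in>{j \<in> {1..m}. h (y j) \<in> B k}. x j *\<^sub>R sgn (w (h (y j))))}"
      using y B m V by (intro prob_le_prob_grouped) (auto simp: h_def \<nu> field_simps)
    also have "\<epsilon> * (real m / (2 * V)) powr (1 / p) = \<delta> * (c * real m powr (1 / p))"
      using c V by (simp add: \<delta>_def powr_divide)
    also have "P.prob {x. \<delta> * (c * real m powr (1 / p))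
          < norm (\<Sum>j\<in>{j \<in> {1..m}. h (y j) \<in> B k}. x j *\<^sub>R sgn (w (h (y j))))}
        \<le> 2 * ?p + real (card {1..m}) * prob {r. c * real m powr (1 / p) < \<bar>r\<bar>}"
      unfolding f_def using a c m(1) T by (intro prob_le_prob_truncated) (auto simp: m_def)
    also have "real (card {1..m}) * prob {r. c * real m powr (1 / p) < \<bar>r\<bar>} \<le> \<epsilon> / 4"
      using tail_c[OF m(1)] by simp
    \<comment> \<open>The chain reads
      \<open>\<epsilon> < 2 * (2 * ?p + \<epsilon> / 4)\<close>.\<close>
    finally have "\<epsilon> / 8 \<le> ?p"
      using large[of k] by simp
    also have "?p = P.prob ((\<lambda>x. (x, y)) -` ?E)"
      by (simp add: space_pair_measure vimage_def)
    finally show "\<epsilon> / 8 \<le> P.prob ((\<lambda>x. (x, y)) -` ?E)" .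
  qed (use \<epsilon> in auto)
  also have "\<dots> = \<Omega>.prob {\<omega>. ?Q (split_seq \<omega>)}"
    by (rule prob_split_seq[OF Q, symmetric])
  also have "\<dots> = \<Omega>.prob {\<omega> \<in> space \<Omega>. \<delta> < dist ((\<Sum>i=1..m. ?X i \<omega>) /\<^sub>R a m) 0}"
  proof -
    have "\<delta> * a m < r \<longleftrightarrow> \<delta> < inverse (a m) * r" for r
      using a(1)[OF m(1)] by (simp add: inverse_eq_divide pos_less_divide_eq)
    then show ?thesis
      using a(1)[OF m(1)] by (simp add: split_seq_def)
  qed
  also have "\<dots> < \<epsilon> / 16"
    by (rule k[OF m(2)])
  finally show False
    using m(3) \<epsilon> mult_left_mono[OF m(3), of "\<epsilon> / 8"] by simp
qed

end

text \<open>Almost sure convergence of the series depends only on the joint law of the stable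
  sequence, which is the product \<open>P\<close> of the common law. The claim for coordinates under
  \<open>P\<close> therefore transfers back to \<open>M\<close>.\<close>

theorem corollary1p1:
  fixes p :: real and a :: "nat \<Rightarrow> real"
  assumes "1 \<le> p" and "p < 2"
    and "\<And>n. n \<ge> 1 \<Longrightarrow> 0 < a n"
    and "strict_mono_on {1..} a"
    and "filterlim a at_top sequentially"
    and "mono_on {1..} (\<lambda>n. real n powr (1 / p) / a n)"
    and "\<And>(M :: (nat \<Rightarrow> 'b::{banach, second_countable_topology}) measure)
             (X :: (nat \<Rightarrow> 'b) \<Rightarrow> 'b) (Xs :: nat \<Rightarrow> (nat \<Rightarrow> 'b) \<Rightarrow> 'b).
           iid_copies M X Xs \<Longrightarrow> symmetric_rv M X \<Longrightarrow>
           tendsto_in_prob M (\<lambda>n \<omega>. (\<Sum>i=1..n. Xs i \<omega>) /\<^sub>R a n) (\<lambda>_. 0) \<longleftrightarrow>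
           (\<lambda>n. real n * measure M {\<omega> \<in> space M. norm (X \<omega>) > a n}) \<longlonglongrightarrow> 0"
  shows "stable_type p TYPE('b)"
  unfolding stable_type_def
proof (intro conjI allI impI)
  show "0 < p" "p \<le> 2" using assms(1,2) by auto
  fix M :: "(nat \<Rightarrow> real) measure" and \<Theta> and v :: "nat \<Rightarrow> 'b"
  assume \<Theta>: "iid_copies M (\<Theta> 1) \<Theta> \<and>
      (\<forall>n\<ge>1. \<forall>t. char (distr M borel (\<Theta> n)) t = of_real (exp (- (\<bar>t\<bar> powr p))))"
    and v: "summable (\<lambda>n. norm (v (Suc n)) powr p)"
  define \<mu> where "\<mu> = distr M borel (\<Theta> 1)"
  interpret M: prob_space M
    using \<Theta> unfolding iid_copies_def by blast
  have indep: "M.indep_vars (\<lambda>_. borel) \<Theta> {1..}"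
    and law_eq: "\<And>j. j \<in> {1..} \<Longrightarrow> distr M borel (\<Theta> j) = \<mu>"
    using \<Theta> unfolding \<mu>_def iid_copies_def atLeast_iff by blast+
  have meas_\<Theta>: "\<Theta> j \<in> borel_measurable M" if "j \<in> {1..}" for j
    using indep that by (auto simp: M.indep_vars_def)
  have \<mu>: "real_distribution \<mu>" "char \<mu> t = of_real (exp (- (\<bar>t\<bar> powr p)))" for t
    using \<Theta> meas_\<Theta>[of 1] unfolding \<mu>_def by (simp_all add: M.real_distribution_distr)
  interpret stable_law \<mu> p
    using assms(1) \<mu>(2) by (intro stable_law.intro \<mu>(1) stable_law_axioms.intro) auto
  have meas: "(\<lambda>\<omega>. \<lambda>j\<in>{1..}. \<Theta> j \<omega>) \<in> M \<rightarrow>\<^sub>M (\<Pi>\<^sub>M _\<in>{1..}. borel)"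
    by (intro measurable_restrict meas_\<Theta>)
  \<comment> \<open>The sequence starts at index 1, the coordinates of \<open>P\<close> at 0; the
    shift by \<open>Suc\<close> also matches the vectors \<open>v (Suc n)\<close>.\<close>
  have shift: "(\<lambda>z :: nat \<Rightarrow> real. \<lambda>j\<in>UNIV. z (Suc j)) \<in> (\<Pi>\<^sub>M _\<in>{1..}. borel) \<rightarrow>\<^sub>M (\<Pi>\<^sub>M _\<in>UNIV. borel)"
    by (intro measurable_restrict measurable_component_singleton) auto
  have comp: "(\<lambda>\<omega> j. \<Theta> (Suc j) \<omega>) = (\<lambda>z. \<lambda>j\<in>UNIV. z (Suc j)) \<circ> (\<lambda>\<omega>. \<lambda>j\<in>{1..}. \<Theta> j \<omega>)"
    by (auto simp: fun_eq_iff)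
  have "distr M (\<Pi>\<^sub>M _\<in>{1..}. borel) (\<lambda>\<omega>. \<lambda>j\<in>{1..}. \<Theta> j \<omega>) = (\<Pi>\<^sub>M _\<in>{1..}. \<mu>)"
    by (intro M.distr_PiM_indep indep law_eq) auto
  then have "distr M (\<Pi>\<^sub>M _\<in>UNIV. borel) (\<lambda>\<omega> j. \<Theta> (Suc j) \<omega>) =
      distr (\<Pi>\<^sub>M _\<in>{1..}. \<mu>) (\<Pi>\<^sub>M _\<in>UNIV. borel) (\<lambda>z. \<lambda>j\<in>UNIV. z (Suc j))"
    unfolding comp using distr_distr[OF shift meas] by simp
  also have "\<dots> = distr (\<Pi>\<^sub>M _\<in>{1..}. \<mu>) P (\<lambda>z. \<lambda>j\<in>UNIV. z (Suc j))"
    by (intro distr_cong) auto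
  also have "\<dots> = P"
    by (rule distr_PiM_reindex) (auto simp: prob_space_axioms)
  finally have law: "distr M (\<Pi>\<^sub>M _\<in>UNIV. borel) (\<lambda>\<omega> j. \<Theta> (Suc j) \<omega>) = P" .
  have "AE x in P. summable (\<lambda>n. x n *\<^sub>R v (Suc n))"
    by (rule AE_summable_of_wlln[OF assms(3,4,6,7) v])
  then show "AE \<omega> in M. summable (\<lambda>n. \<Theta> (Suc n) \<omega> *\<^sub>R v (Suc n))"
    unfolding law[symmetric] using measurable_comp[OF meas shift]
    by (intro AE_distrD[of "\<lambda>\<omega> j. \<Theta> (Suc j) \<omega>" M "\<Pi>\<^sub>M _\<in>UNIV. borel" "\<lambda>x. summable (\<lambda>n. x n *\<^sub>R v (Suc n))"])
      (simp_all add: comp)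
qed

end
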